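(* Let $f:\mathbb{R}^n\to\mathbb{R}$ be bounded below by $f^*\in\mathbb{R}$ and differentiable with Lipschitz continuous gradient with constant $L>0$. Let $\epsilon>0$. Consider the stochastic max-$M$ non-monotone direct search (the algorithm described in the context), with constants $c_{M-1},\eta,\nu$ and merit function $\Phi_k$ as in the context. Suppose: (i) there exist $\kappa\in(0,1]$ and $p\in(0,1]$ such that, for every $k<T_\epsilon$, $P\left(\mathrm{cm}(D_k,-\nabla f(X_k))\ge\kappa\,\middle|\,\mathcal{F}_k\right)\ge p$; (ii) there is a probability $p_0$ such that, for each $k$, with $\beta=\frac12(\eta-c_{M-1})(1-\theta^2)>0$, $$P(\varepsilon_k\ge0\mid\mathcal{F}_{k+1/2})\ge p_0,\qquad P(\varepsilon_k\ge b\mid\mathcal{F}_{k+1/2})\le\frac{\beta\Delta_k^2}{b}\quad\forall b>0;$$ (iii) $pp_0\ln\gamma+(1-pp_0)\ln\theta>0$. Let $\delta_\epsilon=\frac{2\kappa\epsilon}{L+2c}$. Then $$E[T_\epsilon-1]\le\frac{\ln\gamma}{pp_0\ln\gamma+(1-pp_0)\ln\theta}\cdot\frac{\Phi_0}{\nu\theta^2\delta_\epsilon^2}=\frac{\ln\gamma}{pp_0\ln\gamma+(1-pp_0)\ln\theta}\cdot\frac{\Phi_0(L+2c)^2}{4\nu\theta^2\kappa^2\epsilon^2}.$$ Consequently, the expected iteration complexity of the algorithm is $\mathcal{O}(\epsilon^{-2})$.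
   Context: Algorithm (stochastic max-$M$ non-monotone direct search). $F(x,\xi)$ is a stochastic oracle giving noisy observations of $f(x)$. Choose an integer $M>1$, $c>0$, $X_0\in\mathbb{R}^n$, an initial stepsize $\Delta_0>0$, $\theta\in(0,1)$, $\gamma\in(1,\infty)$. For $k=0,1,\dots$: select a random direction $D_k$ uniformly from the unit sphere of $\mathbb{R}^n$ and let $X_k^d=X_k+\Delta_kD_k$. Query the oracle at $X_{succ,k}^i$ ($1\le i\le M-1$), $X_k$ and $X_k^d$, obtaining $F(X_{succ,k}^i,\xi_{k,1}^i)$, $F(X_k,\xi_{k,2})$, $F(X_k^d,\xi_{k,3})$, where the random variables $\xi_{k,1}^i$ ($1\le i\le M-1$), $\xi_{k,2}$, $\xi_{k,3}$ are independent. If $G_k\ge c\Delta_k^2$, where $$G_k=\max\left(F(X_{succ,k}^{M-1},\xi_{k,1}^{M-1}),\ldots,F(X_{succ,k}^1,\xi_{k,1}^1),F(X_k,\xi_{k,2})\right)-F(X_k^d,\xi_{k,3}),$$ then $X_{k+1}=X_k^d$, $\Delta_{k+1}=\gamma\Delta_k$ (iteration $k$ is successful); otherwise $X_{k+1}=X_k$, $\Delta_{k+1}=\theta\Delta_k$ (iteration $k$ is not successful). Here $X_{succ,k}^i$ ($i\ge1$) is the $i$-th latest successful iterate point from $X_k$ if it exists and $X_0$ otherwise; that is, if $s_1>s_2>\cdots$ are the successful iterations with index $<k$ in reverse order, then $X_{succ,k}^i=X_{s_i}$ if $s_i$ exists and $X_{succ,k}^i=X_0$ otherwise. Let $H_k=\max\left(f(X_{succ,k}^{M-1}),\ldots,f(X_{succ,k}^1),f(X_k)\right)-f(X_k^d)$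 and $\varepsilon_k=G_k-H_k$. $\mathcal{F}_k$ is the $\sigma$-algebra generated by the randomness up to the end of iteration $k-1$, and $\mathcal{F}_{k+1/2}$ the one generated by the randomness up to and including $D_k$ (so $X_k^d,H_k$ are $\mathcal{F}_{k+1/2}$-measurable and $G_k,X_{k+1},\Delta_{k+1}$ are $\mathcal{F}_{k+1}$-measurable). $\mathrm{cm}(a,b)=\frac{a^\top b}{\|a\|\|b\|}$ is the cosine measure of the vectors $a,b\in\mathbb{R}^n$. $T_\epsilon=\inf\{k\ge0:\|\nabla f(X_k)\|\le\epsilon\}$; "for every $k<T_\epsilon$" is understood on the event $\{k<T_\epsilon\}$, almost surely. Constants: with $\mathrm{aux}=\theta^2(2\gamma^2-\theta^2-1)(1-\gamma^{2-2M})+(\gamma^2-\theta^2)\left(2\gamma^2-2+(1-\theta^2)(1-\gamma^{2-2M})\right)>0$, $$c_{M-1}=c\,\frac{(2\gamma^2-\theta^2-1)(1-\gamma^{2-2M})}{\mathrm{aux}},\quad \eta=c\,\frac{2\gamma^2-2+(1-\theta^2)(1-\gamma^{2-2M})}{\mathrm{aux}},\quad \nu=c\,\frac{(1-\theta^2)(\gamma^2-1)\gamma^{2-2M}}{\mathrm{aux}},$$ and $c_i=\frac{1-\gamma^{-2i}}{1-\gamma^{2-2M}}c_{M-1}$ for $1\le i\le M-2$. Merit function: $$\Phi_k=\max\left(f(X_{succ,k}^{M-1})-c_{M-1}\Delta_k^2,\ldots,f(X_{succ,k}^1)-c_1\Delta_k^2,f(X_k)\right)-f^*+\eta\Delta_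k^2.$$
   Formalization: The explicit bound on E[T_ε−1] is proved under the added condition θδ_ε ≤ Δ_0, since it fails for very small initial stepsizes; the O(ε^{-2}) conclusion is proved for every Δ_0 when (i) holds for all ε>0 with the same κ and p. *)

theory Defs
  imports "HOL-Probability.Probability"
begin

text \<open>Radial projection of the uniform distribution on the unit ball, i.e. the normalised surface
  measure of the unit sphere.\<close>

definition uniform_sphere :: "'a::euclidean_space measure" where
  "uniform_sphere = distr (uniform_measure lborel (cball 0 1)) borel (\<lambda>x. x /\<^sub>R norm x)"

definition cm :: "'a::real_inner \<Rightarrow> 'a \<Rightarrow> real" where
  "cm a b = (a \<bullet> b) / (norm a * norm b)"

text \<open>The oracle queries of one iteration: \<open>Past i\<close> is the query at the \<open>i\<close>-th latest successful
  iterate point, \<open>Current\<close> the one at \<open>X\<^sub>k\<close>, \<open>Trial\<close> the one at \<open>X\<^sub>k + \<Delta>\<^sub>k D\<^sub>k\<close>. The noise variables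
  \<open>\<xi> k (Past i)\<close>, \<open>\<xi> k Current\<close>, \<open>\<xi> k Trial\<close> are usually written
  \<open>\<xi>\<close> with subscripts \<open>(k,1)\<close> (and superscript \<open>i\<close>), \<open>(k,2)\<close>, \<open>(k,3)\<close>.\<close>

datatype query = Past nat | Current | Trial

definition queries :: "nat \<Rightarrow> query set" where
  "queries M = insert Current (insert Trial (Past ` {1..M - 1}))"

text \<open>A run consists of processes \<open>D\<close> (directions), \<open>\<xi>\<close> (noise), \<open>X\<close> (iterates), \<open>\<Delta>\<close> (stepsizes) and
  \<open>S\<close>, where \<open>S k \<omega>\<close> says that iteration \<open>k\<close> is successful. In \<open>X_succ\<close>, the list enumerates the
  successful iterations before \<open>k\<close>, latest first; it is only used for \<open>i \<ge> 1\<close>.\<close>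

definition X_succ :: "(nat \<Rightarrow> 'w \<Rightarrow> 'a) \<Rightarrow> (nat \<Rightarrow> 'w \<Rightarrow> bool) \<Rightarrow> nat \<Rightarrow> nat \<Rightarrow> 'w \<Rightarrow> 'a" where
  "X_succ X S k i \<omega> =
     (let s = rev (filter (\<lambda>j. S j \<omega>) [0..<k])
      in if i \<le> length s then X (s ! (i - 1)) \<omega> else X 0 \<omega>)"

definition X_trial ::
  "(nat \<Rightarrow> 'w \<Rightarrow> 'a::real_vector) \<Rightarrow> (nat \<Rightarrow> 'w \<Rightarrow> 'a) \<Rightarrow> (nat \<Rightarrow> 'w \<Rightarrow> real) \<Rightarrow> nat \<Rightarrow> 'w \<Rightarrow> 'a" where
  "X_trial D X \<Delta> k \<omega> = X k \<omega> + \<Delta> k \<omega> *\<^sub>R D k \<omega>"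

definition observed_gain ::
  "('a::real_vector \<Rightarrow> 'z \<Rightarrow> real) \<Rightarrow> nat \<Rightarrow> (nat \<Rightarrow> 'w \<Rightarrow> 'a) \<Rightarrow> (nat \<Rightarrow> query \<Rightarrow> 'w \<Rightarrow> 'z) \<Rightarrow>
   (nat \<Rightarrow> 'w \<Rightarrow> 'a) \<Rightarrow> (nat \<Rightarrow> 'w \<Rightarrow> real) \<Rightarrow> (nat \<Rightarrow> 'w \<Rightarrow> bool) \<Rightarrow> nat \<Rightarrow> 'w \<Rightarrow> real" where
  "observed_gain F M D \<xi> X \<Delta> S k \<omega> =
     Max (insert (F (X k \<omega>) (\<xi> k Current \<omega>))
            ((\<lambda>i. F (X_succ X S k i \<omega>) (\<xi> k (Past i) \<omega>)) ` {1..M - 1}))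
     - F (X_trial D X \<Delta> k \<omega>) (\<xi> k Trial \<omega>)"

definition true_gain ::
  "('a::real_vector \<Rightarrow> real) \<Rightarrow> nat \<Rightarrow> (nat \<Rightarrow> 'w \<Rightarrow> 'a) \<Rightarrow>
   (nat \<Rightarrow> 'w \<Rightarrow> 'a) \<Rightarrow> (nat \<Rightarrow> 'w \<Rightarrow> real) \<Rightarrow> (nat \<Rightarrow> 'w \<Rightarrow> bool) \<Rightarrow> nat \<Rightarrow> 'w \<Rightarrow> real" where
  "true_gain f M D X \<Delta> S k \<omega> =
     Max (insert (f (X k \<omega>)) ((\<lambda>i. f (X_succ X S k i \<omega>)) ` {1..M - 1}))
     - f (X_trial D X \<Delta> k \<omega>)"

definition gain_error ::
  "('a::real_vector \<Rightarrow> 'z \<Rightarrow> real) \<Rightarrow> ('a \<Rightarrow> real) \<Rightarrow> nat \<Rightarrow> (nat \<Rightarrow> 'w \<Rightarrow> 'a) \<Rightarrow>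
   (nat \<Rightarrow> query \<Rightarrow> 'w \<Rightarrow> 'z) \<Rightarrow>
   (nat \<Rightarrow> 'w \<Rightarrow> 'a) \<Rightarrow> (nat \<Rightarrow> 'w \<Rightarrow> real) \<Rightarrow> (nat \<Rightarrow> 'w \<Rightarrow> bool) \<Rightarrow> nat \<Rightarrow> 'w \<Rightarrow> real" where
  "gain_error F f M D \<xi> X \<Delta> S k \<omega> = observed_gain F M D \<xi> X \<Delta> S k \<omega> - true_gain f M D X \<Delta> S k \<omega>"

text \<open>The \<open>\<sigma>\<close>-algebra generated by \<open>D\<^sub>j\<close> for \<open>j < a\<close> and by the noise of the iterations \<open>j < b\<close>.\<close>

definition history ::
  "'w measure \<Rightarrow> 'z measure \<Rightarrow> nat \<Rightarrow> (nat \<Rightarrow> 'w \<Rightarrow> 'a::euclidean_space) \<Rightarrow>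
   (nat \<Rightarrow> query \<Rightarrow> 'w \<Rightarrow> 'z) \<Rightarrow> nat \<Rightarrow> nat \<Rightarrow> 'w measure" where
  "history P N M D \<xi> a b = sigma (space P)
     ((\<Union>j<a. sets (vimage_algebra (space P) (D j) borel)) \<union>
      (\<Union>j<b. \<Union>q\<in>queries M. sets (vimage_algebra (space P) (\<xi> j q) N)))"

definition \<F> ::
  "'w measure \<Rightarrow> 'z measure \<Rightarrow> nat \<Rightarrow> (nat \<Rightarrow> 'w \<Rightarrow> 'a::euclidean_space) \<Rightarrow>
   (nat \<Rightarrow> query \<Rightarrow> 'w \<Rightarrow> 'z) \<Rightarrow> nat \<Rightarrow> 'w measure" where
  "\<F> P N M D \<xi> k = history P N M D \<xi> k k"

definition \<F>_half ::
  "'w measure \<Rightarrow> 'z measure \<Rightarrow> nat \<Rightarrow> (nat \<Rightarrow> 'w \<Rightarrow> 'a::euclidean_space) \<Rightarrow>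
   (nat \<Rightarrow> query \<Rightarrow> 'w \<Rightarrow> 'z) \<Rightarrow> nat \<Rightarrow> 'w measure" where
  "\<F>_half P N M D \<xi> k = history P N M D \<xi> (Suc k) k"

text \<open>Conditional probability of the event \<open>{\<omega>. A \<omega>}\<close> given the sub-\<open>\<sigma>\<close>-algebra \<open>G\<close>.\<close>

definition cond_pr :: "'w measure \<Rightarrow> 'w measure \<Rightarrow> ('w \<Rightarrow> bool) \<Rightarrow> 'w \<Rightarrow> real" where
  "cond_pr P G A = real_cond_exp P G (indicat_real {\<omega> \<in> space P. A \<omega>})"

locale max_M_direct_search = prob_space P
  for P :: "'w measure" +
  fixes N :: "'z measure"
    and F :: "'a::euclidean_space \<Rightarrow> 'z \<Rightarrow> real"
    and M :: nat and c \<theta> \<gamma> :: real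
    and x0 :: 'a and \<delta>0 :: real
    and D :: "nat \<Rightarrow> 'w \<Rightarrow> 'a"
    and \<xi> :: "nat \<Rightarrow> query \<Rightarrow> 'w \<Rightarrow> 'z"
    and X :: "nat \<Rightarrow> 'w \<Rightarrow> 'a"
    and \<Delta> :: "nat \<Rightarrow> 'w \<Rightarrow> real"
    and S :: "nat \<Rightarrow> 'w \<Rightarrow> bool"
  assumes oracle_measurable: "(\<lambda>(x, z). F x z) \<in> borel_measurable (borel \<Otimes>\<^sub>M N)"
    and parameters: "1 < M" "0 < c" "0 < \<theta>" "\<theta> < 1" "1 < \<gamma>" "0 < \<delta>0"
    and direction_measurable: "\<And>k. D k \<in> borel_measurable P"
    and direction_uniform: "\<And>k. distr P borel (D k) = uniform_sphere"
    and direction_indep: "\<And>k. indep_set (sets (vimage_algebra (space P) (D k) borel))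
                                        (sets (\<F> P N M D \<xi> k))"
    and noise_indep: "\<And>k. indep_vars (\<lambda>_. N) (\<xi> k) (queries M)"
    and start: "\<And>\<omega>. \<omega> \<in> space P \<Longrightarrow> X 0 \<omega> = x0" "\<And>\<omega>. \<omega> \<in> space P \<Longrightarrow> \<Delta> 0 \<omega> = \<delta>0"
    and success: "\<And>k \<omega>. \<omega> \<in> space P \<Longrightarrow>
           S k \<omega> \<longleftrightarrow> observed_gain F M D \<xi> X \<Delta> S k \<omega> \<ge> c * (\<Delta> k \<omega>)\<^sup>2"
    and next_iterate: "\<And>k \<omega>. \<omega> \<in> space P \<Longrightarrow>
           X (Suc k) \<omega> = (if S k \<omega> then X_trial D X \<Delta> k \<omega> else X k \<omega>)"
    and next_stepsize: "\<And>k \<omega>. \<omega> \<in> space P \<Longrightarrow>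
           \<Delta> (Suc k) \<omega> = (if S k \<omega> then \<gamma> * \<Delta> k \<omega> else \<theta> * \<Delta> k \<omega>)"

definition T_stop ::
  "('a \<Rightarrow> 'b::real_normed_vector) \<Rightarrow> (nat \<Rightarrow> 'w \<Rightarrow> 'a) \<Rightarrow> real \<Rightarrow> 'w \<Rightarrow> enat" where
  "T_stop gradf X \<epsilon> \<omega> = Inf {enat k | k. norm (gradf (X k \<omega>)) \<le> \<epsilon>}"

definition probabilistic_descent ::
  "'w measure \<Rightarrow> 'z measure \<Rightarrow> nat \<Rightarrow> ('a::euclidean_space \<Rightarrow> 'a) \<Rightarrow> (nat \<Rightarrow> 'w \<Rightarrow> 'a) \<Rightarrow>
   (nat \<Rightarrow> query \<Rightarrow> 'w \<Rightarrow> 'z) \<Rightarrow> (nat \<Rightarrow> 'w \<Rightarrow> 'a) \<Rightarrow> real \<Rightarrow> real \<Rightarrow> real \<Rightarrow> bool" where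
  "probabilistic_descent P N M gradf D \<xi> X \<kappa> p \<epsilon> \<longleftrightarrow>
     (\<forall>k. AE \<omega> in P. enat k < T_stop gradf X \<epsilon> \<omega> \<longrightarrow>
        cond_pr P (\<F> P N M D \<xi> k) (\<lambda>\<omega>'. cm (D k \<omega>') (- gradf (X k \<omega>')) \<ge> \<kappa>) \<omega> \<ge> p)"

definition aux_const :: "real \<Rightarrow> real \<Rightarrow> nat \<Rightarrow> real" where
  "aux_const \<theta> \<gamma> M =
     \<theta>\<^sup>2 * (2 * \<gamma>\<^sup>2 - \<theta>\<^sup>2 - 1) * (1 - \<gamma> powi (2 - 2 * int M))
     + (\<gamma>\<^sup>2 - \<theta>\<^sup>2) * (2 * \<gamma>\<^sup>2 - 2 + (1 - \<theta>\<^sup>2) * (1 - \<gamma> powi (2 - 2 * int M)))"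

definition c_last :: "real \<Rightarrow> real \<Rightarrow> real \<Rightarrow> nat \<Rightarrow> real" where
  "c_last c \<theta> \<gamma> M =
     c * ((2 * \<gamma>\<^sup>2 - \<theta>\<^sup>2 - 1) * (1 - \<gamma> powi (2 - 2 * int M)) / aux_const \<theta> \<gamma> M)"

definition eta_const :: "real \<Rightarrow> real \<Rightarrow> real \<Rightarrow> nat \<Rightarrow> real" where
  "eta_const c \<theta> \<gamma> M =
     c * ((2 * \<gamma>\<^sup>2 - 2 + (1 - \<theta>\<^sup>2) * (1 - \<gamma> powi (2 - 2 * int M))) / aux_const \<theta> \<gamma> M)"

definition nu_const :: "real \<Rightarrow> real \<Rightarrow> real \<Rightarrow> nat \<Rightarrow> real" where
  "nu_const c \<theta> \<gamma> M =
     c * ((1 - \<theta>\<^sup>2) * (\<gamma>\<^sup>2 - 1) * \<gamma> powi (2 - 2 * int M) / aux_const \<theta> \<gamma> M)"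

definition beta_const :: "real \<Rightarrow> real \<Rightarrow> real \<Rightarrow> nat \<Rightarrow> real" where
  "beta_const c \<theta> \<gamma> M = 1 / 2 * (eta_const c \<theta> \<gamma> M - c_last c \<theta> \<gamma> M) * (1 - \<theta>\<^sup>2)"

text \<open>For \<open>i = M - 1\<close> the quotient is \<open>1\<close>, so that \<open>c_coef c \<theta> \<gamma> M (M - 1) = c_last c \<theta> \<gamma> M\<close>.\<close>

definition c_coef :: "real \<Rightarrow> real \<Rightarrow> real \<Rightarrow> nat \<Rightarrow> nat \<Rightarrow> real" where
  "c_coef c \<theta> \<gamma> M i =
     (1 - \<gamma> powi (- 2 * int i)) / (1 - \<gamma> powi (2 - 2 * int M)) * c_last c \<theta> \<gamma> M"

definition merit ::
  "('a \<Rightarrow> real) \<Rightarrow> real \<Rightarrow> real \<Rightarrow> real \<Rightarrow> real \<Rightarrow> nat \<Rightarrow>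
   (nat \<Rightarrow> 'w \<Rightarrow> 'a) \<Rightarrow> (nat \<Rightarrow> 'w \<Rightarrow> real) \<Rightarrow> (nat \<Rightarrow> 'w \<Rightarrow> bool) \<Rightarrow> nat \<Rightarrow> 'w \<Rightarrow> real" where
  "merit f fstar c \<theta> \<gamma> M X \<Delta> S k \<omega> =
     Max (insert (f (X k \<omega>))
            ((\<lambda>i. f (X_succ X S k i \<omega>) - c_coef c \<theta> \<gamma> M i * (\<Delta> k \<omega>)\<^sup>2) ` {1..M - 1}))
     - fstar + eta_const c \<theta> \<gamma> M * (\<Delta> k \<omega>)\<^sup>2"

end

theory Submission
  imports Defs
begin

text \<open>
  The merit function is a Lyapunov function for the search. Its coefficients are balanced such that, with
  \<open>K = nu_const * \<Delta>\<^sup>2\<close>, an unsuccessful iteration lowers it by at least \<open>2 * K\<close>, and a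
  successful one lowers it by at least \<open>K\<close> or raises it by at most \<open>b - 2 * K\<close>, where the shortfall
  \<open>b = c * \<Delta>\<^sup>2 - H\<close> is the least error of the oracle with which the iteration succeeds
  (\<open>merit_step_failure\<close>, \<open>merit_step_success\<close>). The value of \<open>b\<close> is determined before the oracle is
  queried. If \<open>b\<close> exceeds \<open>K\<close>, then the tail bound allows an error of at least \<open>b\<close> with conditional probability
  at most \<open>K / b\<close>, because \<open>beta_const\<close> equals \<open>nu_const\<close>. A loss of \<open>b\<close> with that probability costs at most \<open>K\<close> on average, and the
  expected decrease is at least \<open>K\<close> (\<open>random_threshold_tail\<close>, \<open>expected_merit_decrease\<close>). As the merit
  function is nonnegative, the sum of the expected squared stepsizes is bounded by its initial value
  divided by \<open>nu_const\<close>, and this limits the expected number of iterations with a stepsize of at least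
  \<open>r = \<theta> * \<delta>\<close>.

  It remains to see that such iterations are frequent. As long as the gradient is larger than \<open>\<epsilon>\<close>, an
  iteration with stepsize at most \<open>\<delta>\<close> and a descent direction succeeds if the error is nonnegative
  (\<open>success_of_small_step\<close>). Direction and error are favourable together with conditional probability at least
  \<open>p * p0\<close> (\<open>prob_good\<close>). Therefore the logarithm of a small stepsize has drift at least
  \<open>p * p0 * ln \<gamma> + (1 - p * p0) * ln \<theta> > 0\<close>. The potential \<open>log_gap\<close> of the stepsize is zero at the
  start and never positive, so the accumulated drift must be paid for by the visits to stepsizes of at least
  \<open>r\<close>, at \<open>ln \<gamma>\<close> per visit (\<open>sum_running_le_large_steps\<close>). The
  drift times the expected stopping time is thus at most \<open>ln \<gamma>\<close> times the expected number of large steps.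
\<close>

section \<open>The constants of the merit function\<close>

lemma powi_two_minus:
  assumes "1 < M" "1 < (\<gamma>::real)"
  shows "0 < \<gamma> powi (2 - 2 * int M)" "\<gamma> powi (2 - 2 * int M) < 1"
    "\<gamma> powi (2 - 2 * int M) = \<gamma> powi (- 2 * int (M - 1))"
proof -
  have e: "2 - 2 * int M = - int (2 * (M - 1))" "- 2 * int (M - 1) = - int (2 * (M - 1))"
    using assms by auto
  show "0 < \<gamma> powi (2 - 2 * int M)" using assms by simp
  have "1 < \<gamma> ^ (2 * (M - 1))"
    using assms by (intro one_less_power) auto
  then show "\<gamma> powi (2 - 2 * int M) < 1"
    unfolding e(1) power_int_minus power_int_of_nat by (simp add: inverse_less_1_iff)
  show "\<gamma> powi (2 - 2 * int M) = \<gamma> powi (- 2 * int (M - 1))" unfolding e by (rule refl)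
qed

locale search_constants =
  fixes M :: nat and c \<theta> \<gamma> :: real
  assumes M_gt: "1 < M" and c_pos: "0 < c" and theta_pos: "0 < \<theta>" and theta_less: "\<theta> < 1"
    and gamma_gt: "1 < \<gamma>"
begin

lemma square_bounds: "0 < \<theta>\<^sup>2" "\<theta>\<^sup>2 < 1" "1 < \<gamma>\<^sup>2"
  using theta_pos theta_less gamma_gt by (auto simp: power_less_one_iff one_less_power)

lemma aux_const_pos: "0 < aux_const \<theta> \<gamma> M"
  and nu_const_pos: "0 < nu_const c \<theta> \<gamma> M"
  and eta_const_pos: "0 < eta_const c \<theta> \<gamma> M"
  and c_last_pos: "0 < c_last c \<theta> \<gamma> M"
proof -
  note v = powi_two_minus(1,2)[OF M_gt gamma_gt]
  have 1: "0 < (2 * \<gamma>\<^sup>2 - \<theta>\<^sup>2 - 1) * (1 - \<gamma> powi (2 - 2 * int M))"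
    using square_bounds v by (intro mult_pos_pos) auto
  have 2: "0 < 2 * \<gamma>\<^sup>2 - 2 + (1 - \<theta>\<^sup>2) * (1 - \<gamma> powi (2 - 2 * int M))"
    using square_bounds v by (intro add_pos_pos) auto
  show a: "0 < aux_const \<theta> \<gamma> M"
    unfolding aux_const_def mult.assoc
    by (rule add_pos_pos[OF mult_pos_pos[OF _ 1] mult_pos_pos[OF _ 2]]) (use square_bounds in auto)
  show "0 < nu_const c \<theta> \<gamma> M"
    unfolding nu_const_def
    by (rule mult_pos_pos[OF c_pos divide_pos_pos[OF mult_pos_pos[OF mult_pos_pos] a]])
      (use square_bounds v in auto)
  show "0 < eta_const c \<theta> \<gamma> M" "0 < c_last c \<theta> \<gamma> M"
    unfolding eta_const_def c_last_def
    by (rule mult_pos_pos[OF c_pos divide_pos_pos[OF 2 a]], rule mult_pos_pos[OF c_pos divide_pos_pos[OF 1 a]])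
qed

lemma c_coef_0: "c_coef c \<theta> \<gamma> M 0 = 0"
  by (simp add: c_coef_def)

lemma c_coef_le_last:
  assumes "i < M" shows "c_coef c \<theta> \<gamma> M i \<le> c_last c \<theta> \<gamma> M"
proof -
  note v = powi_two_minus(1,2)[OF M_gt gamma_gt]
  have "\<gamma> powi (2 - 2 * int M) \<le> \<gamma> powi (- 2 * int i)"
    unfolding powi_two_minus(3)[OF M_gt gamma_gt] using assms gamma_gt by (intro power_int_increasing) auto
  then have "(1 - \<gamma> powi (- 2 * int i)) / (1 - \<gamma> powi (2 - 2 * int M)) \<le> 1"
    using v by (simp add: divide_le_eq_1)
  then show ?thesis
    unfolding c_coef_def using c_last_pos by (intro mult_left_le_one_le[THEN order_trans] mult_right_mono[of _ 1, THEN order_trans]) auto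
qed

text \<open>This recursion is the reason for the choice of the coefficients: after a successful
  iteration the \<open>i\<close>-th latest point becomes the \<open>Suc i\<close>-th latest one and the squared stepsize is
  multiplied by \<open>\<gamma>\<^sup>2\<close>, and all the terms of the merit function that survive drop by the same amount.\<close>

lemma c_coef_Suc:
  "c_coef c \<theta> \<gamma> M (Suc i) * \<gamma>\<^sup>2
    = c_coef c \<theta> \<gamma> M i + (nu_const c \<theta> \<gamma> M + eta_const c \<theta> \<gamma> M * (\<gamma>\<^sup>2 - 1))"
proof -
  define v where "v = \<gamma> powi (2 - 2 * int M)"
  have v: "0 < v" "v < 1" using powi_two_minus(1,2)[OF M_gt gamma_gt] unfolding v_def by blast+
  have a: "aux_const \<theta> \<gamma> M \<noteq> 0" using aux_const_pos by simp
  have shift: "\<gamma> powi (- 2 * int (Suc i)) * \<gamma>\<^sup>2 = \<gamma> powi (- 2 * int i)"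
  proof -
    have "\<gamma> powi (- 2 * int (Suc i)) * \<gamma> powi 2 = \<gamma> powi (- 2 * int (Suc i) + 2)"
      using gamma_gt by (subst power_int_add) auto
    then show ?thesis by (simp add: algebra_simps)
  qed
  define C where "C = c_last c \<theta> \<gamma> M / (1 - v)"
  have C: "C = c * (2 * \<gamma>\<^sup>2 - \<theta>\<^sup>2 - 1) / aux_const \<theta> \<gamma> M"
    unfolding C_def c_last_def v_def[symmetric] using v by simp
  have "(\<gamma>\<^sup>2 - 1) * C = nu_const c \<theta> \<gamma> M + eta_const c \<theta> \<gamma> M * (\<gamma>\<^sup>2 - 1)"
    unfolding C nu_const_def eta_const_def v_def[symmetric] using a
    by (simp add: divide_simps) (simp add: algebra_simps)
  moreover have "c_coef c \<theta> \<gamma> M (Suc i) * \<gamma>\<^sup>2 = (\<gamma>\<^sup>2 - \<gamma> powi (- 2 * int (Suc i)) * \<gamma>\<^sup>2) * C"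
    unfolding c_coef_def v_def[symmetric] C_def by (simp add: algebra_simps diff_divide_distrib)
  moreover have "c_coef c \<theta> \<gamma> M i = (1 - \<gamma> powi (- 2 * int i)) * C"
    unfolding c_coef_def v_def[symmetric] C_def by simp
  ultimately show ?thesis unfolding shift by (simp add: algebra_simps)
qed

text \<open>A success guarantees an observed decrease \<open>c * \<Delta>\<^sup>2\<close> with respect to the maximum of the unpenalised
  values. Comparing with the penalised maximum costs up to \<open>c_last\<close>, the larger stepsize costs
  \<open>eta_const * (\<gamma>\<^sup>2 - 1)\<close>, and \<open>2 * nu_const\<close> is what is left, all in multiples of \<open>\<Delta>\<^sup>2\<close>.\<close>

lemma constants_trial:
  "c_last c \<theta> \<gamma> M + eta_const c \<theta> \<gamma> M * (\<gamma>\<^sup>2 - 1) = c - 2 * nu_const c \<theta> \<gamma> M"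
proof -
  define g t v A where "g = \<gamma>\<^sup>2" and "t = \<theta>\<^sup>2" and "v = \<gamma> powi (2 - 2 * int M)"
    and "A = aux_const \<theta> \<gamma> M"
  define I where "I = inverse A"
  have "A * I = 1" using aux_const_pos unfolding A_def I_def by simp
  moreover have "A = t * (2 * g - t - 1) * (1 - v) + (g - t) * (2 * g - 2 + (1 - t) * (1 - v))"
    unfolding A_def aux_const_def g_def[symmetric] t_def[symmetric] v_def[symmetric] ..
  ultimately show ?thesis
    unfolding c_last_def eta_const_def nu_const_def divide_inverse
      g_def[symmetric] t_def[symmetric] v_def[symmetric] A_def[symmetric] I_def[symmetric]
    by algebra
qed

lemma constants_failure:
  "c_last c \<theta> \<gamma> M * (1 - \<theta>\<^sup>2) + eta_const c \<theta> \<gamma> M * (\<theta>\<^sup>2 - 1) = - 2 * nu_const c \<theta> \<gamma> M"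
proof -
  define g t v I where "g = \<gamma>\<^sup>2" and "t = \<theta>\<^sup>2" and "v = \<gamma> powi (2 - 2 * int M)"
    and "I = inverse (aux_const \<theta> \<gamma> M)"
  show ?thesis
    unfolding c_last_def eta_const_def nu_const_def divide_inverse
      g_def[symmetric] t_def[symmetric] v_def[symmetric] I_def[symmetric]
    by algebra
qed

text \<open>The allowed error probability is thus calibrated to the guaranteed decrease: half of the decrease
  in an unsuccessful iteration.\<close>

lemma beta_eq_nu: "beta_const c \<theta> \<gamma> M = nu_const c \<theta> \<gamma> M"
  using constants_failure unfolding beta_const_def by argo

end

section \<open>Merit function and success along one trajectory\<close>

text \<open>Along the segment from \<open>x\<close> to \<open>x + v\<close> the difference of the two sides has a nonpositive derivative,
  by the Cauchy-Schwarz inequality and the Lipschitz bound on the gradient.\<close>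

lemma descent_lemma:
  fixes f :: "'a::real_inner \<Rightarrow> real"
  assumes grad: "\<And>x. GDERIV f x :> gradf x" and lip: "L-lipschitz_on UNIV gradf"
  shows "f (x + v) \<le> f x + gradf x \<bullet> v + L / 2 * (norm v)\<^sup>2"
proof -
  define \<phi> where "\<phi> t = f (x + t *\<^sub>R v) - t * (gradf x \<bullet> v) - L / 2 * t\<^sup>2 * (norm v)\<^sup>2" for t :: real
  have D: "(\<phi> has_real_derivative ((gradf (x + t *\<^sub>R v) - gradf x) \<bullet> v - L * t * (norm v)\<^sup>2)) (at t)"
    for t
  proof -
    have "(f has_derivative (\<lambda>h. h \<bullet> gradf (x + t *\<^sub>R v))) (at (x + t *\<^sub>R v))"
      using grad unfolding gderiv_def .
    then have "((\<lambda>t. f (x + t *\<^sub>R v)) has_derivative (\<lambda>h. (h *\<^sub>R v) \<bullet> gradf (x + t *\<^sub>R v))) (at t)"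
      by (rule has_derivative_compose[rotated]) (auto intro!: derivative_eq_intros)
    then have "((\<lambda>t. f (x + t *\<^sub>R v)) has_real_derivative (gradf (x + t *\<^sub>R v) \<bullet> v)) (at t)"
      by (rule has_derivative_imp_has_field_derivative) (simp add: inner_commute)
    then show ?thesis
      unfolding \<phi>_def by (auto intro!: derivative_eq_intros simp: inner_diff_left)
  qed
  have "(gradf (x + t *\<^sub>R v) - gradf x) \<bullet> v - L * t * (norm v)\<^sup>2 \<le> 0" if "0 \<le> t" for t
  proof -
    have "(gradf (x + t *\<^sub>R v) - gradf x) \<bullet> v \<le> norm (gradf (x + t *\<^sub>R v) - gradf x) * norm v"
      by (rule norm_cauchy_schwarz)
    also have "\<dots> \<le> (L * norm (t *\<^sub>R v)) * norm v"
      using lipschitz_onD[OF lip, of "x + t *\<^sub>R v" x]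
      by (intro mult_right_mono) (auto simp: dist_norm)
    finally show ?thesis using that by (simp add: power2_eq_square mult_ac)
  qed
  then have "\<phi> 1 \<le> \<phi> 0"
    by (intro DERIV_nonpos_imp_nonincreasing[OF zero_le_one]) (use D in blast)
  then show ?thesis unfolding \<phi>_def by simp
qed

text \<open>The points whose values enter the maxima, with the current iterate as number \<open>0\<close>. With this
  indexing a successful iteration is a shift by one.\<close>

definition past :: "(nat \<Rightarrow> 'w \<Rightarrow> 'a) \<Rightarrow> (nat \<Rightarrow> 'w \<Rightarrow> bool) \<Rightarrow> nat \<Rightarrow> nat \<Rightarrow> 'w \<Rightarrow> 'a" where
  "past X S k i \<omega> = (if i = 0 then X k \<omega> else X_succ X S k i \<omega>)"

lemma past_at_0: "past X S 0 i \<omega> = X 0 \<omega>"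
  by (simp add: past_def X_succ_def)

lemma past_0: "past X S k 0 \<omega> = X k \<omega>"
  by (simp add: past_def)

lemma past_Suc:
  "past X S (Suc k) (Suc i) \<omega> = (if S k \<omega> then past X S k i \<omega> else past X S k (Suc i) \<omega>)"
  by (auto simp: past_def X_succ_def Let_def nth_Cons')

lemma Max_past:
  assumes "1 < M"
  shows "Max (insert (h 0 (X k \<omega>)) ((\<lambda>i. h i (X_succ X S k i \<omega>)) ` {1..M - 1}))
    = Max ((\<lambda>i. h i (past X S k i \<omega>)) ` {..<M})"
proof -
  have "{..<M} = insert 0 {1..M - 1}" using assms by auto
  then have "(\<lambda>i. h i (past X S k i \<omega>)) ` {..<M}
    = insert (h 0 (X k \<omega>)) ((\<lambda>i. h i (X_succ X S k i \<omega>)) ` {1..M - 1})"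
    by (auto simp: past_def)
  then show ?thesis by simp
qed

context max_M_direct_search
begin

sublocale search_constants M c \<theta> \<gamma>
  using parameters by unfold_locales

lemma lessThan_M_ne: "{..<M} \<noteq> {}"
  using M_gt by auto

lemma past_Suc_0:
  "\<omega> \<in> space P \<Longrightarrow> past X S (Suc k) 0 \<omega> = (if S k \<omega> then X_trial D X \<Delta> k \<omega> else X k \<omega>)"
  by (simp add: past_def next_iterate)

lemma observed_gain_eq:
  "observed_gain F M D \<xi> X \<Delta> S k \<omega>
    = Max ((\<lambda>i. F (past X S k i \<omega>) (\<xi> k (if i = 0 then Current else Past i) \<omega>)) ` {..<M})
      - F (X_trial D X \<Delta> k \<omega>) (\<xi> k Trial \<omega>)"
proof -
  let ?h = "\<lambda>i x. F x (\<xi> k (if i = 0 then Current else Past i) \<omega>)"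
  have "(\<lambda>i. F (X_succ X S k i \<omega>) (\<xi> k (Past i) \<omega>)) ` {1..M - 1}
      = (\<lambda>i. ?h i (X_succ X S k i \<omega>)) ` {1..M - 1}" by (intro image_cong) auto
  then show ?thesis
    unfolding observed_gain_def using Max_past[OF M_gt, of ?h X k \<omega> S] by simp
qed

lemma true_gain_eq:
  "true_gain f M D X \<Delta> S k \<omega>
    = Max ((\<lambda>i. f (past X S k i \<omega>)) ` {..<M}) - f (X_trial D X \<Delta> k \<omega>)"
  unfolding true_gain_def using Max_past[OF M_gt, of "\<lambda>_. f"] by simp

lemma merit_eq:
  "merit f fstar c \<theta> \<gamma> M X \<Delta> S k \<omega>
    = Max ((\<lambda>i. f (past X S k i \<omega>) - c_coef c \<theta> \<gamma> M i * (\<Delta> k \<omega>)\<^sup>2) ` {..<M})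
      - fstar + eta_const c \<theta> \<gamma> M * (\<Delta> k \<omega>)\<^sup>2"
  unfolding merit_def
  using Max_past[OF M_gt, of "\<lambda>i x. f x - c_coef c \<theta> \<gamma> M i * (\<Delta> k \<omega>)\<^sup>2"] by (simp add: c_coef_0)

lemma stepsize_pos: "\<omega> \<in> space P \<Longrightarrow> 0 < \<Delta> k \<omega>"
  using parameters by (induction k) (auto simp: start next_stepsize)

lemma stepsize_le: "\<omega> \<in> space P \<Longrightarrow> \<Delta> k \<omega> \<le> \<gamma> ^ k * \<delta>0"
proof (induction k)
  case (Suc k)
  have "\<theta> * \<Delta> k \<omega> \<le> \<gamma> * \<Delta> k \<omega>"
    using parameters stepsize_pos[OF Suc.prems, of k] by (intro mult_right_mono) auto
  then have "\<Delta> (Suc k) \<omega> \<le> \<gamma> * \<Delta> k \<omega>" using Suc.prems by (simp add: next_stepsize)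
  also have "\<dots> \<le> \<gamma> * (\<gamma> ^ k * \<delta>0)" using Suc parameters by (intro mult_left_mono) auto
  finally show ?case by simp
qed (simp add: start)

text \<open>The amount by which the trial point misses sufficient decrease, judged by exact values:
  iteration \<open>k\<close> is successful if and only if the error of the oracle makes up for it.\<close>

definition shortfall :: "('a \<Rightarrow> real) \<Rightarrow> nat \<Rightarrow> 'w \<Rightarrow> real" where
  "shortfall f k \<omega> = c * (\<Delta> k \<omega>)\<^sup>2 - true_gain f M D X \<Delta> S k \<omega>"

lemma success_iff_error:
  "\<omega> \<in> space P \<Longrightarrow> S k \<omega> \<longleftrightarrow> shortfall f k \<omega> \<le> gain_error F f M D \<xi> X \<Delta> S k \<omega>"
  by (auto simp: success gain_error_def shortfall_def)

text \<open>Only the stepsize shrinks. The penalties \<open>c_coef\<close> are released at most at the rate of the largest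
  one, and the term with \<open>eta_const\<close> outweighs that.\<close>

lemma merit_step_failure:
  assumes \<omega>: "\<omega> \<in> space P" and "\<not> S k \<omega>"
  shows "merit f fstar c \<theta> \<gamma> M X \<Delta> S (Suc k) \<omega> - merit f fstar c \<theta> \<gamma> M X \<Delta> S k \<omega>
    \<le> - 2 * nu_const c \<theta> \<gamma> M * (\<Delta> k \<omega>)\<^sup>2"
proof -
  define d where "d = (\<Delta> k \<omega>)\<^sup>2"
  have d: "0 \<le> d" "(\<Delta> (Suc k) \<omega>)\<^sup>2 = \<theta>\<^sup>2 * d"
    using assms by (auto simp: d_def next_stepsize power_mult_distrib)
  let ?m = "Max ((\<lambda>i. f (past X S k i \<omega>) - c_coef c \<theta> \<gamma> M i * d) ` {..<M})"
  have past: "past X S (Suc k) i \<omega> = past X S k i \<omega>" for i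
    using assms by (cases i) (auto simp: past_Suc past_Suc_0 past_0 next_iterate)
  have "Max ((\<lambda>i. f (past X S (Suc k) i \<omega>) - c_coef c \<theta> \<gamma> M i * (\<theta>\<^sup>2 * d)) ` {..<M})
    \<le> ?m + c_last c \<theta> \<gamma> M * (1 - \<theta>\<^sup>2) * d"
  proof (intro Max.boundedI, goal_cases)
    case (3 a)
    then obtain i where i: "i < M" "a = f (past X S k i \<omega>) - c_coef c \<theta> \<gamma> M i * (\<theta>\<^sup>2 * d)"
      by (auto simp: past)
    have "f (past X S k i \<omega>) - c_coef c \<theta> \<gamma> M i * d \<le> ?m"
      using i by (intro Max_ge) auto
    moreover have "c_coef c \<theta> \<gamma> M i * ((1 - \<theta>\<^sup>2) * d) \<le> c_last c \<theta> \<gamma> M * ((1 - \<theta>\<^sup>2) * d)"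
      using c_coef_le_last[OF i(1)] d square_bounds by (intro mult_right_mono) auto
    moreover have "c_coef c \<theta> \<gamma> M i * (\<theta>\<^sup>2 * d) = c_coef c \<theta> \<gamma> M i * d - c_coef c \<theta> \<gamma> M i * ((1 - \<theta>\<^sup>2) * d)"
      "c_last c \<theta> \<gamma> M * ((1 - \<theta>\<^sup>2) * d) = c_last c \<theta> \<gamma> M * (1 - \<theta>\<^sup>2) * d"
      by (simp_all add: algebra_simps)
    ultimately show ?case unfolding i(2) by linarith
  qed (use lessThan_M_ne in auto)
  moreover have "c_last c \<theta> \<gamma> M * (1 - \<theta>\<^sup>2) * d + eta_const c \<theta> \<gamma> M * (\<theta>\<^sup>2 - 1) * d
      = - 2 * nu_const c \<theta> \<gamma> M * d"
    using constants_failure by (simp flip: distrib_right)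
  moreover have "eta_const c \<theta> \<gamma> M * (\<theta>\<^sup>2 * d) = eta_const c \<theta> \<gamma> M * (\<theta>\<^sup>2 - 1) * d + eta_const c \<theta> \<gamma> M * d"
    by (simp add: algebra_simps)
  ultimately show ?thesis
    unfolding merit_eq d(2) d_def[symmetric] by linarith
qed

text \<open>The maximum defining the new merit value is attained either at an old point, whose penalty has
  grown according to \<open>c_coef_Suc\<close>, or at the trial point, whose value is tied to the old maximum by the
  exact gain. The merit function can grow, but by an amount that is known before the oracle is queried.\<close>

lemma merit_step_success:
  assumes \<omega>: "\<omega> \<in> space P" and "S k \<omega>"
  shows "merit f fstar c \<theta> \<gamma> M X \<Delta> S (Suc k) \<omega> - merit f fstar c \<theta> \<gamma> M X \<Delta> S k \<omega>
    \<le> max (nu_const c \<theta> \<gamma> M * (\<Delta> k \<omega>)\<^sup>2) (shortfall f k \<omega>) - 2 * nu_const c \<theta> \<gamma> M * (\<Delta> k \<omega>)\<^sup>2"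
    (is "_ \<le> ?r")
proof -
  define d where "d = (\<Delta> k \<omega>)\<^sup>2"
  define \<nu> \<eta> where "\<nu> = nu_const c \<theta> \<gamma> M" and "\<eta> = eta_const c \<theta> \<gamma> M"
  have d: "0 \<le> d" "(\<Delta> (Suc k) \<omega>)\<^sup>2 = \<gamma>\<^sup>2 * d"
    using assms by (auto simp: d_def next_stepsize power_mult_distrib)
  let ?m = "Max ((\<lambda>i. f (past X S k i \<omega>) - c_coef c \<theta> \<gamma> M i * d) ` {..<M})"
  let ?b = "shortfall f k \<omega>"
  have old: "f (past X S k i \<omega>) \<le> ?m + c_coef c \<theta> \<gamma> M i * d" if "i < M" for i
  proof -
    have "f (past X S k i \<omega>) - c_coef c \<theta> \<gamma> M i * d \<le> ?m"
      using that by (intro Max_ge) auto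
    then show ?thesis by linarith
  qed
  have "Max ((\<lambda>i. f (past X S (Suc k) i \<omega>) - c_coef c \<theta> \<gamma> M i * (\<gamma>\<^sup>2 * d)) ` {..<M})
    \<le> ?m + max (\<nu> * d) ?b - 2 * \<nu> * d - \<eta> * (\<gamma>\<^sup>2 - 1) * d"
  proof (intro Max.boundedI, goal_cases)
    case (3 a)
    then obtain i where i: "i < M" "a = f (past X S (Suc k) i \<omega>) - c_coef c \<theta> \<gamma> M i * (\<gamma>\<^sup>2 * d)"
      by auto
    show ?case
    proof (cases i)
      case 0
      have "Max ((\<lambda>i. f (past X S k i \<omega>)) ` {..<M}) \<le> ?m + c_last c \<theta> \<gamma> M * d"
      proof (intro Max.boundedI, goal_cases)
        case (3 a)
        then obtain i where i: "i < M" "a = f (past X S k i \<omega>)" by auto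
        have "c_coef c \<theta> \<gamma> M i * d \<le> c_last c \<theta> \<gamma> M * d"
          using c_coef_le_last[OF i(1)] d by (intro mult_right_mono) auto
        then show ?case using old[OF i(1)] i by simp
      qed (use lessThan_M_ne in auto)
      then have "f (X_trial D X \<Delta> k \<omega>) \<le> ?m + c_last c \<theta> \<gamma> M * d - c * d + ?b"
        unfolding shortfall_def true_gain_eq d_def[symmetric] by simp
      moreover have "c_last c \<theta> \<gamma> M * d + \<eta> * (\<gamma>\<^sup>2 - 1) * d = c * d - 2 * \<nu> * d"
        using constants_trial unfolding \<nu>_def \<eta>_def
        by (metis distrib_right left_diff_distrib)
      moreover have "a = f (X_trial D X \<Delta> k \<omega>)"
        using i 0 assms by (simp add: past_Suc_0 c_coef_0)
      ultimately show ?thesis by linarith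
    next
      case (Suc j)
      have "c_coef c \<theta> \<gamma> M i * (\<gamma>\<^sup>2 * d) = (c_coef c \<theta> \<gamma> M j + (\<nu> + \<eta> * (\<gamma>\<^sup>2 - 1))) * d"
        unfolding Suc mult.assoc[symmetric] c_coef_Suc \<nu>_def \<eta>_def ..
      moreover have "f (past X S k j \<omega>) \<le> ?m + c_coef c \<theta> \<gamma> M j * d"
        using i Suc by (intro old) simp
      moreover have "f (past X S (Suc k) i \<omega>) = f (past X S k j \<omega>)"
        using Suc assms by (simp add: past_Suc)
      ultimately have "a \<le> ?m - \<nu> * d - \<eta> * (\<gamma>\<^sup>2 - 1) * d"
        unfolding i(2) distrib_right by linarith
      then show ?thesis by simp
    qed
  qed (use lessThan_M_ne in auto)
  moreover have "\<eta> * (\<gamma>\<^sup>2 * d) = \<eta> * (\<gamma>\<^sup>2 - 1) * d + \<eta> * d"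
    by (simp add: algebra_simps)
  ultimately show ?thesis
    unfolding merit_eq d(2) d_def[symmetric] \<nu>_def[symmetric] \<eta>_def[symmetric]
    by linarith
qed

lemma merit_nonneg:
  assumes "\<And>x. fstar \<le> f x"
  shows "0 \<le> merit f fstar c \<theta> \<gamma> M X \<Delta> S k \<omega>"
proof -
  have "fstar \<le> f (past X S k 0 \<omega>) - c_coef c \<theta> \<gamma> M 0 * (\<Delta> k \<omega>)\<^sup>2"
    using assms by (simp add: c_coef_0)
  also have "\<dots> \<le> Max ((\<lambda>i. f (past X S k i \<omega>) - c_coef c \<theta> \<gamma> M i * (\<Delta> k \<omega>)\<^sup>2) ` {..<M})"
    using M_gt by (intro Max_ge) auto
  finally show ?thesis
    unfolding merit_eq using eta_const_pos by (simp add: add_nonneg_nonneg)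
qed

lemma merit_0_const:
  "\<omega> \<in> space P \<Longrightarrow> \<omega>' \<in> space P \<Longrightarrow>
    merit f fstar c \<theta> \<gamma> M X \<Delta> S 0 \<omega> = merit f fstar c \<theta> \<gamma> M X \<Delta> S 0 \<omega>'"
  by (simp add: merit_eq past_at_0 start)

text \<open>The first-order decrease is at least \<open>\<kappa> * \<epsilon> * \<Delta>\<close>, while the curvature term and the required
  decrease add up to \<open>(L / 2 + c) * \<Delta>\<^sup>2\<close>; the bound on the stepsize is where the two balance.\<close>

lemma success_of_small_step:
  assumes \<omega>: "\<omega> \<in> space P"
    and grad: "\<And>x. GDERIV f x :> gradf x" and lip: "0 < L" "L-lipschitz_on UNIV gradf"
    and \<epsilon>: "0 < \<epsilon>" "\<epsilon> < norm (gradf (X k \<omega>))" and "norm (D k \<omega>) = 1"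
    and \<kappa>: "0 < \<kappa>" "\<kappa> \<le> cm (D k \<omega>) (- gradf (X k \<omega>))"
    and err: "0 \<le> gain_error F f M D \<xi> X \<Delta> S k \<omega>"
    and small: "\<Delta> k \<omega> \<le> 2 * \<kappa> * \<epsilon> / (L + 2 * c)"
  shows "S k \<omega>"
proof -
  let ?g = "gradf (X k \<omega>)" and ?d = "\<Delta> k \<omega>"
  have d: "0 < ?d" using stepsize_pos[OF \<omega>] .
  have "\<kappa> * norm ?g \<le> - (D k \<omega> \<bullet> ?g)"
  proof -
    have "\<kappa> \<le> (- (D k \<omega> \<bullet> ?g)) / norm ?g"
      using \<kappa>(2) assms(7) unfolding cm_def by simp
    moreover have "0 < norm ?g" using \<epsilon> by linarith
    ultimately show ?thesis by (simp only: pos_le_divide_eq)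
  qed
  moreover have "\<kappa> * \<epsilon> \<le> \<kappa> * norm ?g" using \<epsilon> \<kappa> by simp
  ultimately have "\<kappa> * \<epsilon> \<le> - (?g \<bullet> D k \<omega>)" by (simp add: inner_commute)
  then have *: "?d * (\<kappa> * \<epsilon>) \<le> ?d * - (?g \<bullet> D k \<omega>)" using d by (intro mult_left_mono) auto
  have "f (X_trial D X \<Delta> k \<omega>) \<le> f (X k \<omega>) + ?d * (?g \<bullet> D k \<omega>) + L / 2 * ?d\<^sup>2"
    using descent_lemma[OF grad lip(2), of "X k \<omega>" "?d *\<^sub>R D k \<omega>"] assms(7)
    by (simp add: X_trial_def power_mult_distrib)
  moreover have "?d * (?d * (L + 2 * c)) \<le> ?d * (2 * \<kappa> * \<epsilon>)"
    using small lip(1) c_pos d by (intro mult_left_mono) (auto simp: pos_le_divide_eq)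
  ultimately have "c * ?d\<^sup>2 \<le> f (X k \<omega>) - f (X_trial D X \<Delta> k \<omega>)"
  proof -
    have "?d * (?d * (L + 2 * c)) = 2 * (L / 2 * ?d\<^sup>2) + 2 * (c * ?d\<^sup>2)"
      "?d * (2 * \<kappa> * \<epsilon>) = 2 * (?d * (\<kappa> * \<epsilon>))" "?d * - (?g \<bullet> D k \<omega>) = - (?d * (?g \<bullet> D k \<omega>))"
      by (simp_all add: power2_eq_square algebra_simps)
    then show ?thesis using * \<open>f (X_trial D X \<Delta> k \<omega>) \<le> _\<close> \<open>?d * (?d * (L + 2 * c)) \<le> _\<close>
      by linarith
  qed
  also have "f (X k \<omega>) \<le> Max ((\<lambda>i. f (past X S k i \<omega>)) ` {..<M})"
    using M_gt by (intro Max_ge) (auto simp: past_0 intro!: image_eqI[of _ _ 0])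
  finally have "shortfall f k \<omega> \<le> 0"
    unfolding shortfall_def true_gain_eq by linarith
  then show ?thesis
    using err success_iff_error[OF \<omega>, of k f] by linarith
qed

end

section \<open>Conditional probabilities\<close>

lemma finite_measure_subalgebraI: "finite_measure M \<Longrightarrow> subalgebra M G \<Longrightarrow> finite_measure_subalgebra M G"
  by (simp add: finite_measure_subalgebra_def finite_measure_subalgebra_axioms_def)

text \<open>The defining property of the conditional probability, in the form in which it is used below:
  integration over an event of the conditioning \<open>\<sigma>\<close>-algebra.\<close>

lemma (in prob_space) cond_pr_set_integral:
  assumes G: "subalgebra M G" and A: "{\<omega> \<in> space M. A \<omega>} \<in> events" and B: "B \<in> sets G"
  shows "prob (B \<inter> {\<omega> \<in> space M. A \<omega>}) = (\<integral>\<omega>. indicator B \<omega> * cond_pr M G A \<omega> \<partial>M)"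
    and "integrable M (cond_pr M G A)"
proof -
  interpret finite_measure_subalgebra M G
    by (rule finite_measure_subalgebraI[OF finite_measure_axioms G])
  have B': "B \<in> events" using B G by (auto simp: subalgebra_def)
  have i: "integrable M (indicat_real {\<omega> \<in> space M. A \<omega>})"
    using A by (intro integrable_real_indicator) (auto simp: emeasure_eq_measure)
  then show "integrable M (cond_pr M G A)"
    unfolding cond_pr_def by (rule real_cond_exp_int(1))
  have "prob (B \<inter> {\<omega> \<in> space M. A \<omega>}) = (\<integral>\<omega>. indicator (B \<inter> {\<omega> \<in> space M. A \<omega>}) \<omega> \<partial>M)"
    using A B' by simp
  also have "\<dots> = (\<integral>\<omega>. indicator B \<omega> * indicat_real {\<omega> \<in> space M. A \<omega>} \<omega> \<partial>M)"
    by (simp add: indicator_inter_arith)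
  also have "\<dots> = (\<integral>\<omega>. indicator B \<omega> * cond_pr M G A \<omega> \<partial>M)"
    using real_cond_exp_intA[OF i B] unfolding set_lebesgue_integral_def cond_pr_def by simp
  finally show "prob (B \<inter> {\<omega> \<in> space M. A \<omega>}) = (\<integral>\<omega>. indicator B \<omega> * cond_pr M G A \<omega> \<partial>M)" .
qed

lemma (in prob_space) prob_ge_cond_pr:
  assumes G: "subalgebra M G" and A: "{\<omega> \<in> space M. A \<omega>} \<in> events" and B: "B \<in> sets G"
    and q: "AE \<omega> in M. \<omega> \<in> B \<longrightarrow> q \<le> cond_pr M G A \<omega>"
  shows "q * prob B \<le> prob (B \<inter> {\<omega> \<in> space M. A \<omega>})"
proof -
  have B': "B \<in> events" using B G by (auto simp: subalgebra_def)
  have "q * prob B = (\<integral>\<omega>. indicator B \<omega> * q \<partial>M)" using B' by simp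
  also have "\<dots> \<le> (\<integral>\<omega>. indicator B \<omega> * cond_pr M G A \<omega> \<partial>M)"
  proof (rule integral_mono_AE)
    show "integrable M (\<lambda>\<omega>. indicator B \<omega> * q)"
      using B' by (intro integrable_mult_left integrable_real_indicator) (auto simp: emeasure_eq_measure)
    show "integrable M (\<lambda>\<omega>. indicator B \<omega> * cond_pr M G A \<omega>)"
      using integrable_mult_indicator[OF B' cond_pr_set_integral(2)[OF G A B]] by simp
    show "AE \<omega> in M. indicator B \<omega> * q \<le> indicator B \<omega> * cond_pr M G A \<omega>"
      using q by eventually_elim (auto simp: indicator_def)
  qed
  finally show ?thesis unfolding cond_pr_set_integral(1)[OF G A B] .
qed

lemma (in prob_space) prob_le_cond_pr:
  assumes G: "subalgebra M G" and A: "{\<omega> \<in> space M. A \<omega>} \<in> events" and B: "B \<in> sets G"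
    and u: "integrable M u" "AE \<omega> in M. cond_pr M G A \<omega> \<le> u \<omega>"
  shows "prob (B \<inter> {\<omega> \<in> space M. A \<omega>}) \<le> (\<integral>\<omega>. indicator B \<omega> * u \<omega> \<partial>M)"
proof -
  have B': "B \<in> events" using B G by (auto simp: subalgebra_def)
  show ?thesis unfolding cond_pr_set_integral(1)[OF G A B]
  proof (rule integral_mono_AE)
    show "integrable M (\<lambda>\<omega>. indicator B \<omega> * u \<omega>)"
      using integrable_mult_indicator[OF B' u(1)] by simp
    show "integrable M (\<lambda>\<omega>. indicator B \<omega> * cond_pr M G A \<omega>)"
      using integrable_mult_indicator[OF B' cond_pr_set_integral(2)[OF G A B]] by simp
    show "AE \<omega> in M. indicator B \<omega> * cond_pr M G A \<omega> \<le> indicator B \<omega> * u \<omega>"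
      using u(2) by eventually_elim (auto simp: indicator_def)
  qed
qed

text \<open>A tail bound \<open>K / q\<close> for each constant threshold \<open>q\<close> carries over to a threshold \<open>b\<close> that is
  itself random but known at the time of conditioning. The proof rounds \<open>b\<close> down to a grid of
  mesh \<open>h\<close>: on the event that \<open>b\<close> lies in a given cell the rounded threshold is constant, and rounding costs
  at most \<open>h\<close> in total. A bound of order \<open>1 / q\<close> alone does not make the expectation of \<open>e\<close> finite, so it is essential
  that the threshold itself, and not \<open>e\<close>, is integrated.\<close>

lemma (in prob_space) random_threshold_tail:
  assumes G: "subalgebra M G"
    and b: "b \<in> borel_measurable G" and e: "e \<in> borel_measurable M"
    and K: "integrable M K" "\<And>\<omega>. 0 \<le> K \<omega>"
    and B: "B \<in> sets G" "\<And>\<omega>. \<omega> \<in> B \<Longrightarrow> 0 < b \<omega>"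
    and tail: "\<And>q. 0 < q \<Longrightarrow> AE \<omega> in M. cond_pr M G (\<lambda>\<omega>. q \<le> e \<omega>) \<omega> \<le> K \<omega> / q"
  shows "(\<integral>\<omega>. indicator B \<omega> * (if b \<omega> \<le> e \<omega> then b \<omega> else 0) \<partial>M) \<le> (\<integral>\<omega>. indicator B \<omega> * K \<omega> \<partial>M)"
proof (rule field_le_epsilon)
  fix h :: real assume h: "0 < h"
  have sp: "space G = space M" using G by (simp add: subalgebra_def)
  have B': "B \<in> events" using B G by (auto simp: subalgebra_def)
  have [measurable]: "b \<in> borel_measurable M" "e \<in> borel_measurable M" "K \<in> borel_measurable M"
    using measurable_from_subalg[OF G b] e K by auto
  note B'[measurable] b[measurable] B(1)[measurable]
  \<comment> \<open>the event that \<open>b\<close> rounds down to \<open>j * h\<close>\<close>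
  define C where "C j = B \<inter> {\<omega> \<in> space G. real j * h \<le> b \<omega> \<and> b \<omega> < real j * h + h}" for j :: nat
  have C_G: "C j \<in> sets G" for j unfolding C_def by measurable
  then have C_M[measurable]: "C j \<in> events" for j using G by (auto simp: subalgebra_def)
  have C_iff: "\<omega> \<in> C j \<longleftrightarrow> \<omega> \<in> B \<and> j = nat \<lfloor>b \<omega> / h\<rfloor>" for \<omega> j
  proof -
    have "\<omega> \<in> B \<Longrightarrow> \<omega> \<in> space G" using B(1) sets.sets_into_space by blast
    moreover have "real j * h \<le> b \<omega> \<and> b \<omega> < real j * h + h \<longleftrightarrow> real j \<le> b \<omega> / h \<and> b \<omega> / h < real j + 1"
      using h by (simp add: pos_le_divide_eq pos_divide_less_eq algebra_simps)
    moreover have "real j \<le> b \<omega> / h \<and> b \<omega> / h < real j + 1 \<longleftrightarrow> j = nat \<lfloor>b \<omega> / h\<rfloor>" if "0 < b \<omega>"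
    proof -
      have "0 \<le> \<lfloor>b \<omega> / h\<rfloor>" using that h by simp
      then show ?thesis by (auto simp: floor_eq_iff) linarith+
    qed
    ultimately show ?thesis using B(2) unfolding C_def by auto
  qed
  have C_Un: "(\<Union>j. C j) = B" using C_iff by blast
  have C_disj: "disjoint_family C" using C_iff by (auto simp: disjoint_family_on_def)
  have split: "(\<integral>\<^sup>+\<omega>\<in>B. g \<omega> \<partial>M) = (\<Sum>j. \<integral>\<^sup>+\<omega>\<in>C j. g \<omega> \<partial>M)"
    if "g \<in> borel_measurable M" for g :: "'a \<Rightarrow> ennreal"
    unfolding C_Un[symmetric] using that C_M C_disj by (intro nn_integral_disjoint_family) auto
  have int_ind: "integrable M (\<lambda>\<omega>. indicator E \<omega> * K \<omega>)" if "E \<in> events" for E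
    using integrable_mult_indicator[OF that K(1)] by simp
  have int_ind': "integrable M (\<lambda>\<omega>. indicator E \<omega> * (K \<omega> + h))" if "E \<in> events" for E
    using integrable_mult_indicator[OF that, of "\<lambda>\<omega>. K \<omega> + h"] K(1) by simp
  have piece: "(\<integral>\<^sup>+\<omega>\<in>C j. ennreal (if b \<omega> \<le> e \<omega> then b \<omega> else 0) \<partial>M)
    \<le> (\<integral>\<^sup>+\<omega>\<in>C j. ennreal (K \<omega> + h) \<partial>M)" for j
  proof -
    let ?E = "{\<omega> \<in> space M. real j * h \<le> e \<omega>}"
    have E[measurable]: "?E \<in> events" by measurable
    have "(\<integral>\<^sup>+\<omega>\<in>C j. ennreal (if b \<omega> \<le> e \<omega> then b \<omega> else 0) \<partial>M)
      \<le> (\<integral>\<^sup>+\<omega>. ennreal (real j * h + h) * indicator (C j \<inter> ?E) \<omega> \<partial>M)"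
      using h by (intro nn_integral_mono) (auto simp: C_def indicator_def sp simp del: ennreal_plus intro!: ennreal_leI)
    also have "\<dots> = ennreal ((real j * h + h) * prob (C j \<inter> ?E))"
      using h by (subst nn_integral_cmult_indicator) (auto simp: emeasure_eq_measure ennreal_mult)
    also have "\<dots> \<le> ennreal (\<integral>\<omega>. indicator (C j) \<omega> * (K \<omega> + h) \<partial>M)"
    proof (rule ennreal_leI)
      have "real j * h * prob (C j \<inter> ?E) \<le> (\<integral>\<omega>. indicator (C j) \<omega> * K \<omega> \<partial>M)"
      proof (cases "j = 0")
        case False
        then have q: "0 < real j * h" using h by simp
        have "prob (C j \<inter> ?E) \<le> (\<integral>\<omega>. indicator (C j) \<omega> * (K \<omega> / (real j * h)) \<partial>M)"
          using K(1) by (intro prob_le_cond_pr[OF G E C_G _ tail[OF q]]) simp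
        also have "\<dots> = (\<integral>\<omega>. indicator (C j) \<omega> * K \<omega> \<partial>M) / (real j * h)" by simp
        finally show ?thesis using q by (simp add: pos_le_divide_eq mult.commute)
      qed (use K(2) in \<open>auto intro!: integral_nonneg_AE\<close>)
      moreover have "h * prob (C j \<inter> ?E) \<le> h * prob (C j)"
        using h by (intro mult_left_mono finite_measure_mono) auto
      moreover have "(\<integral>\<omega>. indicator (C j) \<omega> * (K \<omega> + h) \<partial>M)
          = (\<integral>\<omega>. indicator (C j) \<omega> * K \<omega> \<partial>M) + h * prob (C j)"
        unfolding distrib_left
        by (subst Bochner_Integration.integral_add[OF int_ind]) (auto simp: emeasure_eq_measure)
      ultimately show "(real j * h + h) * prob (C j \<inter> ?E) \<le> (\<integral>\<omega>. indicator (C j) \<omega> * (K \<omega> + h) \<partial>M)"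
        by (simp add: distrib_right)
    qed
    also have "\<dots> = (\<integral>\<^sup>+\<omega>. ennreal (indicator (C j) \<omega> * (K \<omega> + h)) \<partial>M)"
      using K(2) h by (intro nn_integral_eq_integral[symmetric] int_ind') (auto intro!: AE_I2 mult_nonneg_nonneg add_nonneg_nonneg)
    also have "\<dots> = (\<integral>\<^sup>+\<omega>\<in>C j. ennreal (K \<omega> + h) \<partial>M)"
      by (intro nn_integral_cong) (auto simp: indicator_def)
    finally show ?thesis .
  qed
  have "(\<integral>\<^sup>+\<omega>. ennreal (indicator B \<omega> * (if b \<omega> \<le> e \<omega> then b \<omega> else 0)) \<partial>M)
      = (\<integral>\<^sup>+\<omega>\<in>B. ennreal (if b \<omega> \<le> e \<omega> then b \<omega> else 0) \<partial>M)"
    by (intro nn_integral_cong) (auto simp: indicator_def)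
  also have "\<dots> \<le> (\<integral>\<^sup>+\<omega>\<in>B. ennreal (K \<omega> + h) \<partial>M)"
    using piece by (subst (1 2) split) (auto intro!: suminf_le)
  also have "\<dots> = (\<integral>\<^sup>+\<omega>. ennreal (indicator B \<omega> * (K \<omega> + h)) \<partial>M)"
    by (intro nn_integral_cong) (auto simp: indicator_def)
  also have "\<dots> = ennreal (\<integral>\<omega>. indicator B \<omega> * (K \<omega> + h) \<partial>M)"
    using K(2) h by (intro nn_integral_eq_integral int_ind' B') (auto intro!: AE_I2 mult_nonneg_nonneg add_nonneg_nonneg)
  finally have "(\<integral>\<omega>. indicator B \<omega> * (if b \<omega> \<le> e \<omega> then b \<omega> else 0) \<partial>M) \<le> (\<integral>\<omega>. indicator B \<omega> * (K \<omega> + h) \<partial>M)"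
    using K(2) h by (intro integral_real_bounded integral_nonneg_AE) (auto intro!: AE_I2 mult_nonneg_nonneg add_nonneg_nonneg)
  also have "\<dots> = (\<integral>\<omega>. indicator B \<omega> * K \<omega> \<partial>M) + h * prob B"
    unfolding distrib_left
    by (subst Bochner_Integration.integral_add[OF int_ind[OF B']]) (auto simp: emeasure_eq_measure)
  also have "\<dots> \<le> (\<integral>\<omega>. indicator B \<omega> * K \<omega> \<partial>M) + h"
    using h prob_le_1[of B] by (simp add: mult_left_le)
  finally show "(\<integral>\<omega>. indicator B \<omega> * (if b \<omega> \<le> e \<omega> then b \<omega> else 0) \<partial>M) \<le> \<dots>" .
qed

section \<open>Measurability and boundedness of the search\<close>

text \<open>The projection sends the centre of the ball to \<open>0\<close>, so the norm is \<open>1\<close> only almost everywhere.\<close>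

lemma uniform_sphere_norm: "AE x in (uniform_sphere :: 'a::euclidean_space measure). norm x = 1"
proof -
  have "AE x in (lborel :: 'a measure). x \<noteq> 0"
    by (intro AE_I'[of "{0}"]) (auto simp: null_sets_def)
  then have "AE x in uniform_measure lborel (cball (0::'a) 1). x \<noteq> 0"
    by (intro AE_uniform_measureI) auto
  then have "AE x in uniform_measure lborel (cball (0::'a) 1). norm (x /\<^sub>R norm x) = 1"
    by eventually_elim simp
  then show ?thesis
    unfolding uniform_sphere_def by (subst AE_distr_iff) auto
qed

context max_M_direct_search
begin

lemma direction_norm: "AE \<omega> in P. norm (D k \<omega>) = 1"
proof -
  have "AE x in distr P borel (D k). norm x = 1"
    unfolding direction_uniform by (rule uniform_sphere_norm)
  then show ?thesis
    using direction_measurable[of k] by (subst (asm) AE_distr_iff) auto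
qed

lemma noise_measurable:
  assumes "q \<in> queries M" shows "\<xi> k q \<in> measurable P N"
  using noise_indep[of k] assms unfolding indep_vars_def2 by auto

abbreviation hist :: "nat \<Rightarrow> nat \<Rightarrow> 'w measure" where
  "hist \<equiv> history P N M D \<xi>"

lemma history_generators:
  "(\<Union>j<a. sets (vimage_algebra (space P) (D j) borel)) \<union>
      (\<Union>j<b. \<Union>q\<in>queries M. sets (vimage_algebra (space P) (\<xi> j q) N)) \<subseteq> sets P"
proof -
  have "sets (vimage_algebra (space P) (D j) borel) \<subseteq> sets P" for j
    by (intro sets_image_in_sets direction_measurable refl)
  moreover have "sets (vimage_algebra (space P) (\<xi> j q) N) \<subseteq> sets P" if "q \<in> queries M" for j q
    by (intro sets_image_in_sets noise_measurable that refl)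
  ultimately show ?thesis by blast
qed

lemma sets_history:
  "sets (hist a b) = sigma_sets (space P)
     ((\<Union>j<a. sets (vimage_algebra (space P) (D j) borel)) \<union>
      (\<Union>j<b. \<Union>q\<in>queries M. sets (vimage_algebra (space P) (\<xi> j q) N)))"
  unfolding history_def
  by (rule sets_measure_of) (use history_generators sets.space_closed in blast)

lemma space_history: "space (hist a b) = space P"
  unfolding history_def
  by (rule space_measure_of) (use history_generators sets.space_closed in blast)

lemma subalgebra_history: "subalgebra P (hist a b)"
  unfolding subalgebra_def space_history sets_history
  using sets.sigma_sets_subset[OF history_generators] by simp

lemma history_mono:
  assumes "a \<le> a'" "b \<le> b'" shows "subalgebra (hist a' b') (hist a b)"
  unfolding subalgebra_def space_history sets_history
  using assms by (auto intro!: sigma_sets_mono' UN_mono)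

lemma measurable_history_mono:
  "g \<in> measurable (hist a b) Y \<Longrightarrow> a \<le> a' \<Longrightarrow> b \<le> b' \<Longrightarrow> g \<in> measurable (hist a' b') Y"
  by (rule measurable_from_subalg[OF history_mono])

lemma measurable_history: "g \<in> measurable (hist a b) Y \<Longrightarrow> g \<in> measurable P Y"
  by (rule measurable_from_subalg[OF subalgebra_history])

lemma direction_measurable_history:
  assumes "j < a" shows "D j \<in> measurable (hist a b) borel"
proof -
  have "sets (vimage_algebra (space P) (D j) borel) \<subseteq> sets (hist a b)"
    unfolding sets_history using assms by (auto intro!: sigma_sets.Basic)
  then have "subalgebra (hist a b) (vimage_algebra (space P) (D j) borel)"
    by (simp add: subalgebra_def space_history)
  then show ?thesis
    by (rule measurable_from_subalg) (rule measurable_vimage_algebra1, simp)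
qed

lemma noise_measurable_history:
  assumes "j < b" "q \<in> queries M" shows "\<xi> j q \<in> measurable (hist a b) N"
proof -
  have "sets (vimage_algebra (space P) (\<xi> j q) N) \<subseteq> sets (hist a b)"
    unfolding sets_history using assms by (auto intro!: sigma_sets.Basic)
  then have "subalgebra (hist a b) (vimage_algebra (space P) (\<xi> j q) N)"
    by (simp add: subalgebra_def space_history)
  then show ?thesis
    by (rule measurable_from_subalg)
      (rule measurable_vimage_algebra1, use measurable_space[OF noise_measurable[OF assms(2)]] in auto)
qed

lemma oracle_comp_measurable:
  assumes "x \<in> borel_measurable G" "z \<in> measurable G N"
  shows "(\<lambda>\<omega>. F (x \<omega>) (z \<omega>)) \<in> borel_measurable G"
  using measurable_compose[OF measurable_Pair[OF assms] oracle_measurable] by simp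

lemma trial_measurable:
  assumes "X k \<in> borel_measurable (hist k k)" "\<Delta> k \<in> borel_measurable (hist k k)"
  shows "X_trial D X \<Delta> k \<in> borel_measurable (hist (Suc k) k)"
proof -
  have "X k \<in> borel_measurable (hist (Suc k) k)" "\<Delta> k \<in> borel_measurable (hist (Suc k) k)"
    using assms[THEN measurable_history_mono] by simp_all
  then show ?thesis
    unfolding X_trial_def[abs_def] using direction_measurable_history[of k "Suc k" k]
    by measurable
qed

lemma observed_gain_measurable:
  assumes "\<And>i. past X S k i \<in> borel_measurable (hist k k)" "\<Delta> k \<in> borel_measurable (hist k k)"
  shows "observed_gain F M D \<xi> X \<Delta> S k \<in> borel_measurable (hist (Suc k) (Suc k))"
proof -
  have X: "X k \<in> borel_measurable (hist k k)"
    using assms(1)[of 0] unfolding past_def[abs_def] by simp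
  have [measurable]: "X_trial D X \<Delta> k \<in> borel_measurable (hist (Suc k) (Suc k))"
    by (rule measurable_history_mono[OF trial_measurable[OF X assms(2)]]) auto
  have [measurable]: "past X S k i \<in> borel_measurable (hist (Suc k) (Suc k))" for i
    by (rule measurable_history_mono[OF assms(1)]) auto
  have "(\<lambda>\<omega>. F (past X S k i \<omega>) (\<xi> k (if i = 0 then Current else Past i) \<omega>))
      \<in> borel_measurable (hist (Suc k) (Suc k))" if "i < M" for i
    using that by (intro oracle_comp_measurable noise_measurable_history)
      (auto simp: queries_def)
  then have "(\<lambda>\<omega>. Max ((\<lambda>i. F (past X S k i \<omega>) (\<xi> k (if i = 0 then Current else Past i) \<omega>)) ` {..<M}))
      \<in> borel_measurable (hist (Suc k) (Suc k))"
    by (intro borel_measurable_Max) auto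
  moreover have "(\<lambda>\<omega>. F (X_trial D X \<Delta> k \<omega>) (\<xi> k Trial \<omega>)) \<in> borel_measurable (hist (Suc k) (Suc k))"
    by (intro oracle_comp_measurable noise_measurable_history) (auto simp: queries_def)
  ultimately show ?thesis
    unfolding observed_gain_eq[abs_def] by (rule borel_measurable_diff)
qed

text \<open>The success of iteration \<open>k\<close> is decided by the observed gain, which by induction is a function of the
  directions and the noise up to that iteration. All the retained points are carried through the induction,
  because the iterate and the retained points at the next step are drawn from them.\<close>

lemma process_measurable:
  "(\<forall>i. past X S k i \<in> borel_measurable (hist k k)) \<and> \<Delta> k \<in> borel_measurable (hist k k)"
proof (induction k)
  case 0
  have "past X S 0 i \<in> borel_measurable (hist 0 0) \<longleftrightarrow> (\<lambda>_. x0) \<in> borel_measurable (hist 0 0)" for i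
    by (rule measurable_cong) (simp add: past_at_0 start space_history)
  moreover have "\<Delta> 0 \<in> borel_measurable (hist 0 0) \<longleftrightarrow> (\<lambda>_. \<delta>0) \<in> borel_measurable (hist 0 0)"
    by (rule measurable_cong) (simp add: start space_history)
  ultimately show ?case by simp
next
  case (Suc k)
  let ?G = "hist (Suc k) (Suc k)"
  have IH: "past X S k i \<in> borel_measurable (hist k k)" "\<Delta> k \<in> borel_measurable (hist k k)" for i
    using Suc by auto
  have X: "X k \<in> borel_measurable (hist k k)"
    using IH(1)[of 0] unfolding past_def[abs_def] by simp
  have [measurable]: "past X S k i \<in> borel_measurable ?G" "\<Delta> k \<in> borel_measurable ?G"
    "X k \<in> borel_measurable ?G" "X_trial D X \<Delta> k \<in> borel_measurable ?G"
    "observed_gain F M D \<xi> X \<Delta> S k \<in> borel_measurable ?G" for i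
    using IH[THEN measurable_history_mono] X[THEN measurable_history_mono]
      trial_measurable[OF X IH(2), THEN measurable_history_mono] observed_gain_measurable[OF IH]
    by simp_all
  have "{\<omega> \<in> space ?G. S k \<omega>} = {\<omega> \<in> space ?G. c * (\<Delta> k \<omega>)\<^sup>2 \<le> observed_gain F M D \<xi> X \<Delta> S k \<omega>}"
    by (auto simp: success space_history)
  also have "\<dots> \<in> sets ?G" by measurable
  finally have S: "{\<omega> \<in> space ?G. S k \<omega>} \<in> sets ?G" .
  have "past X S (Suc k) i \<in> borel_measurable ?G" for i
  proof (cases i)
    case 0
    have "past X S (Suc k) 0 \<in> borel_measurable ?G \<longleftrightarrow>
      (\<lambda>\<omega>. if S k \<omega> then X_trial D X \<Delta> k \<omega> else X k \<omega>) \<in> borel_measurable ?G"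
      by (rule measurable_cong) (simp add: past_Suc_0 space_history)
    then show ?thesis using S 0 by (auto intro: measurable_If)
  next
    case (Suc j)
    have "past X S (Suc k) (Suc j) =
      (\<lambda>\<omega>. if S k \<omega> then past X S k j \<omega> else past X S k (Suc j) \<omega>)"
      by (simp add: past_Suc fun_eq_iff)
    then show ?thesis using S Suc by (auto intro: measurable_If)
  qed
  moreover have "\<Delta> (Suc k) \<in> borel_measurable ?G \<longleftrightarrow>
      (\<lambda>\<omega>. if S k \<omega> then \<gamma> * \<Delta> k \<omega> else \<theta> * \<Delta> k \<omega>) \<in> borel_measurable ?G"
    by (rule measurable_cong) (simp add: next_stepsize space_history)
  moreover have "(\<lambda>\<omega>. if S k \<omega> then \<gamma> * \<Delta> k \<omega> else \<theta> * \<Delta> k \<omega>) \<in> borel_measurable ?G"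
    by (rule measurable_If[OF _ _ S]) measurable
  ultimately show ?case by simp
qed

lemma adapted:
  assumes "k \<le> a" "k \<le> b"
  shows "past X S k i \<in> borel_measurable (hist a b)" "X k \<in> borel_measurable (hist a b)"
    "\<Delta> k \<in> borel_measurable (hist a b)"
proof -
  show p: "past X S k i \<in> borel_measurable (hist a b)" for i
    using process_measurable by (blast intro: measurable_history_mono[OF _ assms])
  show "X k \<in> borel_measurable (hist a b)"
    using p[of 0] unfolding past_def[abs_def] by simp
  show "\<Delta> k \<in> borel_measurable (hist a b)"
    using process_measurable by (blast intro: measurable_history_mono[OF _ assms])
qed

lemma random_variables:
  "past X S k i \<in> borel_measurable P" "X k \<in> borel_measurable P" "\<Delta> k \<in> borel_measurable P"
  by (rule measurable_history, rule adapted[OF le_refl le_refl])+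

lemma true_gain_measurable:
  assumes f: "f \<in> borel_measurable borel"
  shows "true_gain f M D X \<Delta> S k \<in> borel_measurable (hist (Suc k) k)"
proof -
  have [measurable]: "past X S k i \<in> borel_measurable (hist (Suc k) k)"
    "X_trial D X \<Delta> k \<in> borel_measurable (hist (Suc k) k)" for i
    using adapted trial_measurable by auto
  note f[measurable]
  show ?thesis unfolding true_gain_eq[abs_def] by measurable
qed

lemma gain_error_measurable:
  assumes f: "f \<in> borel_measurable borel"
  shows "gain_error F f M D \<xi> X \<Delta> S k \<in> borel_measurable P"
proof -
  have "observed_gain F M D \<xi> X \<Delta> S k \<in> borel_measurable P"
    "true_gain f M D X \<Delta> S k \<in> borel_measurable P"
    using observed_gain_measurable[OF adapted(1,3), THEN measurable_history]
      true_gain_measurable[OF f, THEN measurable_history] by simp_all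
  then show ?thesis unfolding gain_error_def[abs_def] by measurable
qed

text \<open>Almost surely the directions have unit norm, and the stepsizes are at most \<open>\<gamma> ^ k * \<delta>0\<close>, so after finitely many iterations
  the points stay in a fixed ball. This makes every continuous function of them integrable.\<close>

lemma past_bounded: "\<exists>R. AE \<omega> in P. \<forall>i. norm (past X S k i \<omega>) \<le> R"
proof (induction k)
  case 0
  show ?case by (rule exI[of _ "norm x0"]) (auto simp: past_at_0 start)
next
  case (Suc k)
  then obtain R where R: "AE \<omega> in P. \<forall>i. norm (past X S k i \<omega>) \<le> R" by blast
  have "AE \<omega> in P. \<forall>i. norm (past X S (Suc k) i \<omega>) \<le> R + \<gamma> ^ k * \<delta>0"
    using R direction_norm[of k] AE_space
  proof eventually_elim
    case (elim \<omega>)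
    have pos: "0 < \<Delta> k \<omega>" "\<Delta> k \<omega> \<le> \<gamma> ^ k * \<delta>0"
      using stepsize_pos stepsize_le elim(3) by auto
    have X: "norm (X k \<omega>) \<le> R" using elim(1) past_0 by metis
    have tr: "norm (X_trial D X \<Delta> k \<omega>) \<le> R + \<gamma> ^ k * \<delta>0"
      unfolding X_trial_def using norm_triangle_ineq[of "X k \<omega>" "\<Delta> k \<omega> *\<^sub>R D k \<omega>"] X pos elim(2)
      by simp
    have "norm (past X S k i \<omega>) \<le> R + \<gamma> ^ k * \<delta>0" for i
      using spec[OF elim(1), of i] pos by linarith
    moreover have "norm (X k \<omega>) \<le> R + \<gamma> ^ k * \<delta>0" using X pos by linarith
    ultimately have "norm (past X S (Suc k) i \<omega>) \<le> R + \<gamma> ^ k * \<delta>0" for i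
      using tr elim(3) by (cases i) (auto simp: past_Suc past_Suc_0)
    then show ?case by blast
  qed
  then show ?case by blast
qed

end

section \<open>Expected decrease of the merit function\<close>

lemma (in prob_space) integrable_comp_bounded:
  fixes Y :: "'a \<Rightarrow> 'b::euclidean_space" and f :: "'b \<Rightarrow> real"
  assumes f: "continuous_on UNIV f" and Y: "Y \<in> borel_measurable M"
    and R: "AE \<omega> in M. norm (Y \<omega>) \<le> R"
  shows "integrable M (\<lambda>\<omega>. f (Y \<omega>))"
proof -
  have "compact (f ` cball 0 R)"
    by (intro compact_continuous_image continuous_on_subset[OF f] compact_cball) auto
  then obtain C where C: "\<And>x. x \<in> cball 0 R \<Longrightarrow> norm (f x) \<le> C"
    by (meson bounded_iff compact_imp_bounded imageI)
  have "AE \<omega> in M. norm (f (Y \<omega>)) \<le> C"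
    using R by eventually_elim (use C in auto)
  moreover have "(\<lambda>\<omega>. f (Y \<omega>)) \<in> borel_measurable M"
    using Y borel_measurable_continuous_onI[OF f] by measurable
  ultimately show ?thesis by (intro integrable_const_bound)
qed

context max_M_direct_search
begin

lemma integrable_past:
  assumes f: "continuous_on UNIV f" shows "integrable P (\<lambda>\<omega>. f (past X S k i \<omega>) :: real)"
proof -
  obtain R where "AE \<omega> in P. \<forall>i. norm (past X S k i \<omega>) \<le> R" using past_bounded by blast
  then have "AE \<omega> in P. norm (past X S k i \<omega>) \<le> R" by eventually_elim blast
  then show ?thesis by (rule integrable_comp_bounded[OF f random_variables(1)])
qed

lemma integrable_trial:
  assumes f: "continuous_on UNIV f" shows "integrable P (\<lambda>\<omega>. f (X_trial D X \<Delta> k \<omega>) :: real)"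
proof -
  obtain R where "AE \<omega> in P. \<forall>i. norm (past X S k i \<omega>) \<le> R" using past_bounded by blast
  then have "AE \<omega> in P. norm (X_trial D X \<Delta> k \<omega>) \<le> R + \<gamma> ^ k * \<delta>0"
    using direction_norm[of k] AE_space
  proof eventually_elim
    case (elim \<omega>)
    then show ?case
      using norm_triangle_ineq[of "X k \<omega>" "\<Delta> k \<omega> *\<^sub>R D k \<omega>"] spec[OF elim(1), of 0]
        stepsize_pos[of \<omega> k] stepsize_le[of \<omega> k]
      by (simp add: X_trial_def past_0)
  qed
  then show ?thesis
    by (rule integrable_comp_bounded[OF f measurable_history[OF trial_measurable[OF adapted(2,3)]], rotated 4])
      auto
qed

lemma integrable_stepsize_sq: "integrable P (\<lambda>\<omega>. (\<Delta> k \<omega>)\<^sup>2)"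
proof (rule integrable_const_bound)
  show "AE \<omega> in P. norm ((\<Delta> k \<omega>)\<^sup>2) \<le> (\<gamma> ^ k * \<delta>0)\<^sup>2"
  proof (rule AE_I2)
    fix \<omega> assume \<omega>: "\<omega> \<in> space P"
    show "norm ((\<Delta> k \<omega>)\<^sup>2) \<le> (\<gamma> ^ k * \<delta>0)\<^sup>2"
      using power_mono[OF stepsize_le[OF \<omega>], of k 2] stepsize_pos[OF \<omega>, of k] by simp
  qed
  show "(\<lambda>\<omega>. (\<Delta> k \<omega>)\<^sup>2) \<in> borel_measurable P" using random_variables(3) by measurable
qed

lemma integrable_merit:
  assumes f: "continuous_on UNIV f"
  shows "integrable P (merit f fstar c \<theta> \<gamma> M X \<Delta> S k)"
  unfolding merit_eq[abs_def]
  by (intro Bochner_Integration.integrable_add Bochner_Integration.integrable_diff integrable_MAX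
      integrable_mult_right integrable_stepsize_sq integrable_past f)
    (use lessThan_M_ne in auto)

lemma integrable_shortfall:
  assumes f: "continuous_on UNIV f" shows "integrable P (shortfall f k)"
  unfolding shortfall_def[abs_def] true_gain_eq
  by (intro Bochner_Integration.integrable_diff integrable_MAX
      integrable_mult_right integrable_stepsize_sq integrable_past integrable_trial f)
    (use lessThan_M_ne in auto)

text \<open>The two cases of a step combine as follows. Write \<open>K\<close> for \<open>nu_const * \<Delta>\<^sup>2\<close>, which is also the
  numerator of the tail bound. If the shortfall is at most \<open>K\<close>, the merit function drops by at least \<open>K\<close>
  whatever the oracle returns. If the shortfall exceeds \<open>K\<close>, the drop is at least \<open>2 * K\<close> except when
  the error reaches the shortfall, and then at most the shortfall is lost again. That loss times its
  probability is at most \<open>K\<close>, so a drop of \<open>K\<close> remains on average.\<close>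

lemma expected_merit_decrease:
  assumes f: "continuous_on UNIV f"
    and tail: "\<And>b. 0 < b \<Longrightarrow> AE \<omega> in P.
      cond_pr P (\<F>_half P N M D \<xi> k) (\<lambda>\<omega>'. b \<le> gain_error F f M D \<xi> X \<Delta> S k \<omega>') \<omega>
        \<le> beta_const c \<theta> \<gamma> M * (\<Delta> k \<omega>)\<^sup>2 / b"
  shows "(\<integral>\<omega>. merit f fstar c \<theta> \<gamma> M X \<Delta> S (Suc k) \<omega> \<partial>P)
    \<le> (\<integral>\<omega>. merit f fstar c \<theta> \<gamma> M X \<Delta> S k \<omega> \<partial>P) - nu_const c \<theta> \<gamma> M * (\<integral>\<omega>. (\<Delta> k \<omega>)\<^sup>2 \<partial>P)"
proof -
  let ?G = "hist (Suc k) k"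
  define \<nu> where "\<nu> = nu_const c \<theta> \<gamma> M"
  define K where "K \<omega> = \<nu> * (\<Delta> k \<omega>)\<^sup>2" for \<omega>
  let ?b = "shortfall f k" and ?e = "gain_error F f M D \<xi> X \<Delta> S k"
  \<comment> \<open>Only here can a success raise the merit function by more than \<open>- K\<close>.\<close>
  define B where "B = {\<omega> \<in> space P. K \<omega> < ?b \<omega>}"
  have fm: "f \<in> borel_measurable borel" using f by (rule borel_measurable_continuous_onI)
  have \<nu>: "0 < \<nu>" unfolding \<nu>_def by (rule nu_const_pos)
  have K0: "0 \<le> K \<omega>" for \<omega> unfolding K_def using \<nu> by simp
  have K_int: "integrable P K" unfolding K_def by (intro integrable_mult_right integrable_stepsize_sq)
  have [measurable]: "\<Delta> k \<in> borel_measurable ?G" "true_gain f M D X \<Delta> S k \<in> borel_measurable ?G"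
    using adapted(3) true_gain_measurable[OF fm] by auto
  have b[measurable]: "?b \<in> borel_measurable ?G" unfolding shortfall_def[abs_def] by measurable
  have "{\<omega> \<in> space ?G. K \<omega> < ?b \<omega>} \<in> sets ?G" unfolding K_def by measurable
  then have B: "B \<in> sets ?G" by (simp add: B_def space_history)
  then have B': "B \<in> events" using subalgebra_history by (auto simp: subalgebra_def)
  have e: "?e \<in> borel_measurable P" by (rule gain_error_measurable[OF fm])
  have main: "(\<integral>\<omega>. indicator B \<omega> * (if ?b \<omega> \<le> ?e \<omega> then ?b \<omega> else 0) \<partial>P) \<le> (\<integral>\<omega>. indicator B \<omega> * K \<omega> \<partial>P)"
  proof (rule random_threshold_tail[OF subalgebra_history b e K_int K0 B])
    show "0 < ?b \<omega>" if "\<omega> \<in> B" for \<omega>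
      using that K0[of \<omega>] unfolding B_def by simp
    show "AE \<omega> in P. cond_pr P ?G (\<lambda>\<omega>. q \<le> ?e \<omega>) \<omega> \<le> K \<omega> / q" if "0 < q" for q
      using tail[OF that] unfolding \<F>_half_def beta_eq_nu K_def \<nu>_def .
  qed
  have int_BK: "integrable P (\<lambda>\<omega>. indicator B \<omega> * K \<omega>)"
    using integrable_mult_indicator[OF B' K_int] by simp
  have int_Bb: "integrable P (\<lambda>\<omega>. indicator B \<omega> * (if ?b \<omega> \<le> ?e \<omega> then ?b \<omega> else 0))"
  proof (rule Bochner_Integration.integrable_bound[OF integrable_shortfall[OF f, of k]])
    show "(\<lambda>\<omega>. indicator B \<omega> * (if ?b \<omega> \<le> ?e \<omega> then ?b \<omega> else 0)) \<in> borel_measurable P"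
      using B' e measurable_history[OF b] by measurable
  qed (auto simp: indicator_def)
  have "(\<integral>\<omega>. merit f fstar c \<theta> \<gamma> M X \<Delta> S (Suc k) \<omega> - merit f fstar c \<theta> \<gamma> M X \<Delta> S k \<omega> \<partial>P)
    \<le> (\<integral>\<omega>. (indicator B \<omega> * (if ?b \<omega> \<le> ?e \<omega> then ?b \<omega> else 0) - indicator B \<omega> * K \<omega>) - K \<omega> \<partial>P)"
  proof (rule integral_mono)
    fix \<omega> assume \<omega>: "\<omega> \<in> space P"
    show "merit f fstar c \<theta> \<gamma> M X \<Delta> S (Suc k) \<omega> - merit f fstar c \<theta> \<gamma> M X \<Delta> S k \<omega>
      \<le> (indicator B \<omega> * (if ?b \<omega> \<le> ?e \<omega> then ?b \<omega> else 0) - indicator B \<omega> * K \<omega>) - K \<omega>"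
    proof (cases "S k \<omega>")
      case True
      then have "?b \<omega> \<le> ?e \<omega>" using success_iff_error[OF \<omega>] by blast
      then show ?thesis
        using merit_step_success[OF \<omega> True, of f fstar] \<omega>
        unfolding \<nu>_def[symmetric] mult.assoc K_def[symmetric] by (auto simp: B_def indicator_def)
    next
      case False
      then have "\<not> ?b \<omega> \<le> ?e \<omega>" using success_iff_error[OF \<omega>] by blast
      then show ?thesis
        using merit_step_failure[OF \<omega> False, of f fstar] K0[of \<omega>]
        unfolding \<nu>_def[symmetric] mult.assoc K_def[symmetric] by (auto simp: indicator_def)
    qed
  qed (intro Bochner_Integration.integrable_diff integrable_merit f int_Bb int_BK K_int)+
  also have "\<dots> = (\<integral>\<omega>. indicator B \<omega> * (if ?b \<omega> \<le> ?e \<omega> then ?b \<omega> else 0) \<partial>P)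
      - (\<integral>\<omega>. indicator B \<omega> * K \<omega> \<partial>P) - (\<integral>\<omega>. K \<omega> \<partial>P)"
    by (simp only: Bochner_Integration.integral_diff int_Bb int_BK K_int Bochner_Integration.integrable_diff)
  also have "\<dots> \<le> - (\<integral>\<omega>. K \<omega> \<partial>P)" using main by simp
  also have "(\<integral>\<omega>. K \<omega> \<partial>P) = \<nu> * (\<integral>\<omega>. (\<Delta> k \<omega>)\<^sup>2 \<partial>P)" unfolding K_def by simp
  finally show ?thesis
    unfolding \<nu>_def by (subst (asm) Bochner_Integration.integral_diff) (auto intro: integrable_merit f)
qed

lemma sum_expected_stepsize_sq:
  assumes f: "continuous_on UNIV f" and fstar: "\<And>x. fstar \<le> f x"
    and tail: "\<And>k b. 0 < b \<Longrightarrow> AE \<omega> in P.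
      cond_pr P (\<F>_half P N M D \<xi> k) (\<lambda>\<omega>'. b \<le> gain_error F f M D \<xi> X \<Delta> S k \<omega>') \<omega>
        \<le> beta_const c \<theta> \<gamma> M * (\<Delta> k \<omega>)\<^sup>2 / b"
    and \<omega>0: "\<omega>0 \<in> space P"
  shows "nu_const c \<theta> \<gamma> M * (\<Sum>k<n. \<integral>\<omega>. (\<Delta> k \<omega>)\<^sup>2 \<partial>P) \<le> merit f fstar c \<theta> \<gamma> M X \<Delta> S 0 \<omega>0"
proof -
  let ?E = "\<lambda>k. \<integral>\<omega>. merit f fstar c \<theta> \<gamma> M X \<Delta> S k \<omega> \<partial>P"
  have "nu_const c \<theta> \<gamma> M * (\<Sum>k<n. \<integral>\<omega>. (\<Delta> k \<omega>)\<^sup>2 \<partial>P) \<le> ?E 0 - ?E n"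
  proof (induction n)
    case (Suc n)
    then show ?case using expected_merit_decrease[where k = n and fstar = fstar, OF f tail] by (simp add: distrib_left)
  qed simp
  moreover have "0 \<le> ?E n" by (intro Bochner_Integration.integral_nonneg merit_nonneg fstar)
  moreover have "?E 0 = (\<integral>\<omega>. merit f fstar c \<theta> \<gamma> M X \<Delta> S 0 \<omega>0 \<partial>P)"
    by (intro Bochner_Integration.integral_cong refl merit_0_const \<omega>0)
  ultimately show ?thesis by (simp add: prob_space)
qed

end

section \<open>Growth of the stepsize and the stopping time\<close>

text \<open>A potential that measures how far the stepsize lies below the level \<open>r\<close>. The jump by \<open>ln \<gamma>\<close> at the
  level makes up for the overshoot: a successful step that crosses the level gains at least \<open>ln \<gamma>\<close>, although
  the logarithm is cut off there.\<close>

definition log_gap :: "real \<Rightarrow> real \<Rightarrow> real \<Rightarrow> real" where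
  "log_gap \<gamma> r z = (if z < r then ln (z / r) - ln \<gamma> else 0)"

lemma log_gap_nonpos: "1 < \<gamma> \<Longrightarrow> 0 < r \<Longrightarrow> 0 < z \<Longrightarrow> log_gap \<gamma> r z \<le> 0"
proof -
  assume "1 < \<gamma>" "0 < r" "0 < z"
  then have "ln (z / r) < 0" if "z < r" using that by simp
  moreover have "0 < ln \<gamma>" using \<open>1 < \<gamma>\<close> by simp
  ultimately show ?thesis unfolding log_gap_def by (simp del: ln_less_zero_iff ln_gt_zero_iff) linarith
qed

text \<open>Below the level \<open>r\<close> a good iteration is successful and raises the potential by at least \<open>ln \<gamma>\<close>; any
  iteration loses at most \<open>- ln \<theta>\<close>. At or above the level the potential is \<open>0\<close>. It can then drop by at most
  \<open>ln \<gamma> - ln \<theta>\<close>, of which the last summand compensates \<open>ln \<gamma>\<close>. A good iteration that starts between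
  \<open>r\<close> and \<open>r / \<theta>\<close> is successful, and one step from above \<open>r / \<theta>\<close> cannot cross the level, so good iterations
  never cause a drop.\<close>

lemma log_gap_step:
  assumes \<theta>: "0 < \<theta>" "\<theta> < 1" and \<gamma>: "1 < \<gamma>" and r: "0 < r" and z: "0 < z"
    and good: "good \<Longrightarrow> z \<le> r / \<theta> \<Longrightarrow> s"
  shows "(if good then ln \<gamma> else ln \<theta>)
    \<le> log_gap \<gamma> r (if s then \<gamma> * z else \<theta> * z) - log_gap \<gamma> r z + (if r \<le> z then ln \<gamma> else 0)"
proof -
  have ln: "ln \<theta> < 0" "0 < ln \<gamma>" using \<theta> \<gamma> by auto
  have lnz: "ln (\<gamma> * z / r) = ln \<gamma> + ln (z / r)" "ln (\<theta> * z / r) = ln \<theta> + ln (z / r)"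
    using \<theta> \<gamma> r z by (simp_all add: ln_div ln_mult)
  show ?thesis
  proof (cases "z < r")
    case True
    then have neg: "ln (z / r) < 0" using r z by simp
    show ?thesis
    proof (cases s)
      case True
      then show ?thesis using \<open>z < r\<close> neg ln by (auto simp: log_gap_def lnz)
    next
      case False
      have "\<theta> * r \<le> r" "\<theta> * z \<le> z" using \<theta> r z by (auto intro: mult_left_le_one_le)
      then have "z \<le> r / \<theta>" "\<theta> * z < r" using \<open>z < r\<close> \<theta> by (auto simp: pos_le_divide_eq mult.commute)
      then show ?thesis using False good \<open>z < r\<close> by (auto simp: log_gap_def lnz)
    qed
  next
    case False
    then have nonneg: "0 \<le> ln (z / r)" using r z by simp
    show ?thesis
    proof (cases s)
      case True
      have "z \<le> \<gamma> * z" using \<gamma> z by simp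
      then show ?thesis using True False ln by (auto simp: log_gap_def)
    next
      case nos: False
      have "\<not> \<theta> * z < r" if good
        using good[OF that] nos \<theta> by (auto simp: pos_le_divide_eq mult.commute not_le)
      then show ?thesis using nos False ln nonneg by (auto simp: log_gap_def lnz)
    qed
  qed
qed

lemma stopped_telescope:
  fixes a :: "nat \<Rightarrow> real"
  assumes "\<And>k. active (Suc k) \<Longrightarrow> active k"
  shows "\<exists>m\<le>n. (\<Sum>k<n. if active k then a (Suc k) - a k else 0) = a m - a 0 \<and> ((\<forall>k<n. active k) \<longrightarrow> m = n)"
proof (induction n)
  case (Suc n)
  then obtain m where m: "m \<le> n" "(\<Sum>k<n. if active k then a (Suc k) - a k else 0) = a m - a 0"
      "(\<forall>k<n. active k) \<longrightarrow> m = n" by blast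
  have down: "active k" if "active n" "k \<le> n" for k
    using that(2,1) by (induction rule: inc_induct) (use assms in auto)
  show ?case
  proof (cases "active n")
    case True
    then have "m = n" using m(3) down by auto
    then show ?thesis using m True by (intro exI[of _ "Suc n"]) auto
  next
    case False
    then show ?thesis using m by (intro exI[of _ m]) auto
  qed
qed simp

lemma enat_less_T_stop_iff:
  "enat k < T_stop gradf X \<epsilon> \<omega> \<longleftrightarrow> (\<forall>j\<le>k. \<epsilon> < norm (gradf (X j \<omega>)))"
proof -
  have "enat k < T_stop gradf X \<epsilon> \<omega> \<longleftrightarrow> (\<forall>j. norm (gradf (X j \<omega>)) \<le> \<epsilon> \<longrightarrow> enat (Suc k) \<le> enat j)"
    unfolding T_stop_def Suc_ile_eq[symmetric] le_Inf_iff by auto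
  also have "\<dots> \<longleftrightarrow> (\<forall>j\<le>k. \<epsilon> < norm (gradf (X j \<omega>)))"
    by (auto simp: not_le[symmetric] Suc_le_eq)
  finally show ?thesis .
qed

lemma T_stop_antimono: "\<epsilon> \<le> \<epsilon>' \<Longrightarrow> T_stop gradf X \<epsilon>' \<omega> \<le> T_stop gradf X \<epsilon> \<omega>"
  unfolding T_stop_def by (intro Inf_superset_mono) auto

text \<open>The condition on the directions refers to the accuracy \<open>\<epsilon>\<close>. It is a hypothesis of the individual lemmas,
  so that \<open>\<epsilon>\<close> can vary within the locale.\<close>

locale noisy_max_M_search = max_M_direct_search P N F M c \<theta> \<gamma> x0 \<delta>0 D \<xi> X \<Delta> S
  for P :: "'w measure" and N :: "'z measure" and F :: "'a::euclidean_space \<Rightarrow> 'z \<Rightarrow> real"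
    and M :: nat and c \<theta> \<gamma> :: real and x0 :: 'a and \<delta>0 :: real
    and D :: "nat \<Rightarrow> 'w \<Rightarrow> 'a" and \<xi> :: "nat \<Rightarrow> query \<Rightarrow> 'w \<Rightarrow> 'z"
    and X :: "nat \<Rightarrow> 'w \<Rightarrow> 'a" and \<Delta> :: "nat \<Rightarrow> 'w \<Rightarrow> real" and S :: "nat \<Rightarrow> 'w \<Rightarrow> bool" +
  fixes f :: "'a \<Rightarrow> real" and gradf :: "'a \<Rightarrow> 'a" and fstar L \<kappa> p p0 :: real
  assumes bounded_below: "\<And>x. fstar \<le> f x"
    and gradient: "\<And>x. GDERIV f x :> gradf x"
    and L_pos: "0 < L" and lipschitz: "L-lipschitz_on UNIV gradf"
    and kappa_pos: "0 < \<kappa>" and p0_nonneg: "0 \<le> p0"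
    and error_nonneg: "\<And>k. AE \<omega> in P.
      p0 \<le> cond_pr P (\<F>_half P N M D \<xi> k) (\<lambda>\<omega>'. 0 \<le> gain_error F f M D \<xi> X \<Delta> S k \<omega>') \<omega>"
    and error_tail: "\<And>k b. 0 < b \<Longrightarrow> AE \<omega> in P.
      cond_pr P (\<F>_half P N M D \<xi> k) (\<lambda>\<omega>'. b \<le> gain_error F f M D \<xi> X \<Delta> S k \<omega>') \<omega>
        \<le> beta_const c \<theta> \<gamma> M * (\<Delta> k \<omega>)\<^sup>2 / b"
    and drift_pos: "0 < p * p0 * ln \<gamma> + (1 - p * p0) * ln \<theta>"
begin

lemma f_continuous: "continuous_on UNIV f"
proof (rule continuous_at_imp_continuous_on, safe)
  fix x show "isCont f x"
    using gradient[of x] unfolding gderiv_def by (rule has_derivative_continuous)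
qed

lemma gradf_measurable [measurable]: "gradf \<in> borel_measurable borel"
  by (intro borel_measurable_continuous_onI lipschitz_on_continuous_on[OF lipschitz])

definition running :: "real \<Rightarrow> nat \<Rightarrow> 'w set" where
  "running \<epsilon> k = {\<omega> \<in> space P. enat k < T_stop gradf X \<epsilon> \<omega>}"

definition good :: "nat \<Rightarrow> 'w set" where
  "good k = {\<omega> \<in> space P. \<kappa> \<le> cm (D k \<omega>) (- gradf (X k \<omega>))}
    \<inter> {\<omega> \<in> space P. 0 \<le> gain_error F f M D \<xi> X \<Delta> S k \<omega>}"

lemma running_in_history: "running \<epsilon> k \<in> sets (hist k k)"
proof -
  have "{\<omega> \<in> space (hist k k). \<forall>j\<in>{..k}. \<epsilon> < norm (gradf (X j \<omega>))} \<in> sets (hist k k)"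
  proof (rule sets.sets_Collect_finite_All)
    fix j assume "j \<in> {..k}"
    then have [measurable]: "X j \<in> borel_measurable (hist k k)" by (intro adapted(2)) auto
    show "{\<omega> \<in> space (hist k k). \<epsilon> < norm (gradf (X j \<omega>))} \<in> sets (hist k k)" by measurable
  qed simp
  also have "{\<omega> \<in> space (hist k k). \<forall>j\<in>{..k}. \<epsilon> < norm (gradf (X j \<omega>))} = running \<epsilon> k"
    unfolding running_def enat_less_T_stop_iff space_history by blast
  finally show ?thesis .
qed

lemma running_event [measurable]: "running \<epsilon> k \<in> events"
  using running_in_history subalgebra_history[of k k] by (auto simp: subalgebra_def)

lemma direction_event: "{\<omega> \<in> space P. \<kappa> \<le> cm (D k \<omega>) (- gradf (X k \<omega>))} \<in> sets (hist (Suc k) k)"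
proof -
  have [measurable]: "X k \<in> borel_measurable (hist (Suc k) k)" "D k \<in> borel_measurable (hist (Suc k) k)"
    by (auto intro: adapted(2) direction_measurable_history)
  have "{\<omega> \<in> space (hist (Suc k) k). \<kappa> \<le> cm (D k \<omega>) (- gradf (X k \<omega>))} \<in> sets (hist (Suc k) k)"
    unfolding cm_def by measurable
  then show ?thesis by (simp add: space_history)
qed

lemma error_event: "{\<omega> \<in> space P. 0 \<le> gain_error F f M D \<xi> X \<Delta> S k \<omega>} \<in> events"
proof -
  have [measurable]: "gain_error F f M D \<xi> X \<Delta> S k \<in> borel_measurable P"
    by (intro gain_error_measurable borel_measurable_continuous_onI f_continuous)
  show ?thesis by measurable
qed

lemma good_event [measurable]: "good k \<in> events"
  unfolding good_def using direction_event[of k] error_event[of k] subalgebra_history[of "Suc k" k]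
  by (auto simp: subalgebra_def)

text \<open>Condition first on the direction, then on the past: whether the direction is good is known when the
  oracle is queried, so the two probabilities multiply.\<close>

lemma prob_good:
  assumes descent: "probabilistic_descent P N M gradf D \<xi> X \<kappa> p \<epsilon>"
  shows "p * p0 * prob (running \<epsilon> k) \<le> prob (running \<epsilon> k \<inter> good k)"
proof -
  let ?C = "{\<omega> \<in> space P. \<kappa> \<le> cm (D k \<omega>) (- gradf (X k \<omega>))}"
  let ?E = "{\<omega> \<in> space P. 0 \<le> gain_error F f M D \<xi> X \<Delta> S k \<omega>}"
  have C: "?C \<in> events"
    using direction_event[of k] subalgebra_history[of "Suc k" k] by (auto simp: subalgebra_def)
  have "AE \<omega> in P. enat k < T_stop gradf X \<epsilon> \<omega> \<longrightarrow>
      p \<le> cond_pr P (hist k k) (\<lambda>\<omega>'. \<kappa> \<le> cm (D k \<omega>') (- gradf (X k \<omega>'))) \<omega>"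
    using descent unfolding probabilistic_descent_def \<F>_def by blast
  then have "AE \<omega> in P. \<omega> \<in> running \<epsilon> k \<longrightarrow>
      p \<le> cond_pr P (hist k k) (\<lambda>\<omega>'. \<kappa> \<le> cm (D k \<omega>') (- gradf (X k \<omega>'))) \<omega>"
    by eventually_elim (simp add: running_def)
  then have "p * prob (running \<epsilon> k) \<le> prob (running \<epsilon> k \<inter> ?C)"
    by (rule prob_ge_cond_pr[OF subalgebra_history C running_in_history])
  then have "p0 * (p * prob (running \<epsilon> k)) \<le> p0 * prob (running \<epsilon> k \<inter> ?C)"
    using p0_nonneg by (rule mult_left_mono)
  also have "\<dots> \<le> prob ((running \<epsilon> k \<inter> ?C) \<inter> ?E)"
  proof (rule prob_ge_cond_pr[OF subalgebra_history error_event])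
    have "running \<epsilon> k \<in> sets (hist (Suc k) k)"
      using running_in_history history_mono[of k "Suc k" k k] by (auto simp: subalgebra_def)
    then show "running \<epsilon> k \<inter> ?C \<in> sets (hist (Suc k) k)" using direction_event by blast
    show "AE \<omega> in P. \<omega> \<in> running \<epsilon> k \<inter> ?C \<longrightarrow>
        p0 \<le> cond_pr P (hist (Suc k) k) (\<lambda>\<omega>'. 0 \<le> gain_error F f M D \<xi> X \<Delta> S k \<omega>') \<omega>"
      using error_nonneg[of k] unfolding \<F>_half_def by eventually_elim simp
  qed
  also have "(running \<epsilon> k \<inter> ?C) \<inter> ?E = running \<epsilon> k \<inter> good k" by (auto simp: good_def)
  finally show ?thesis by (simp add: mult_ac)
qed

definition large_step :: "real \<Rightarrow> nat \<Rightarrow> 'w set" where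
  "large_step r k = {\<omega> \<in> space P. r \<le> \<Delta> k \<omega>}"

lemma large_step_event [measurable]: "large_step r k \<in> events"
  using random_variables(3) unfolding large_step_def by measurable

text \<open>Sum \<open>log_gap_step\<close> up to the stopping time. The potential starts at \<open>0\<close> because the initial stepsize
  is at least \<open>\<theta> * \<delta>\<close>, and it never becomes positive, so the telescoped sum has the favourable sign, and each
  running iteration contributes at least the drift on average.\<close>

lemma sum_running_le_large_steps:
  assumes \<epsilon>: "0 < \<epsilon>" and \<delta>: "\<delta> = 2 * \<kappa> * \<epsilon> / (L + 2 * c)" and start_large: "\<theta> * \<delta> \<le> \<delta>0"
    and descent: "probabilistic_descent P N M gradf D \<xi> X \<kappa> p \<epsilon>"
  shows "(p * p0 * ln \<gamma> + (1 - p * p0) * ln \<theta>) * (\<Sum>k<n. prob (running \<epsilon> k))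
    \<le> ln \<gamma> * (\<Sum>k<n. prob (running \<epsilon> k \<inter> large_step (\<theta> * \<delta>) k))"
proof -
  define r where "r = \<theta> * \<delta>"
  have \<delta>_pos: "0 < \<delta>" unfolding \<delta> using \<epsilon> kappa_pos L_pos c_pos by (intro divide_pos_pos) auto
  then have r: "0 < r" "r / \<theta> = \<delta>" unfolding r_def using theta_pos by auto
  have ln: "ln \<theta> < 0" "0 < ln \<gamma>" using theta_pos theta_less gamma_gt by auto
  let ?W = "running \<epsilon>"
  have pointwise: "AE \<omega> in P.
      (\<Sum>k<n. (ln \<gamma> - ln \<theta>) * indicator (?W k \<inter> good k) \<omega> + ln \<theta> * indicator (?W k) \<omega>)
      \<le> (\<Sum>k<n. ln \<gamma> * indicator (?W k \<inter> large_step r k) \<omega>)"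
  proof -
    have "AE \<omega> in P. \<forall>k. norm (D k \<omega>) = 1" using direction_norm by (simp add: AE_all_countable)
    then show ?thesis using AE_space
    proof eventually_elim
      case (elim \<omega>)
      then have \<omega>: "\<omega> \<in> space P" and D: "norm (D k \<omega>) = 1" for k by auto
      let ?a = "\<lambda>k. log_gap \<gamma> r (\<Delta> k \<omega>)"
      have step: "(ln \<gamma> - ln \<theta>) * indicator (?W k \<inter> good k) \<omega> + ln \<theta> * indicator (?W k) \<omega>
        \<le> ln \<gamma> * indicator (?W k \<inter> large_step r k) \<omega>
          + (if \<omega> \<in> ?W k then ?a (Suc k) - ?a k else 0)" for k
      proof (cases "\<omega> \<in> ?W k")
        case True
        then have grad: "\<epsilon> < norm (gradf (X k \<omega>))"
          unfolding running_def enat_less_T_stop_iff by blast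
        have "S k \<omega>" if "\<omega> \<in> good k" "\<Delta> k \<omega> \<le> r / \<theta>"
        proof (rule success_of_small_step[OF \<omega> gradient L_pos lipschitz \<epsilon> grad D kappa_pos])
          show "\<kappa> \<le> cm (D k \<omega>) (- gradf (X k \<omega>))" "0 \<le> gain_error F f M D \<xi> X \<Delta> S k \<omega>"
            using that(1) unfolding good_def by auto
          show "\<Delta> k \<omega> \<le> 2 * \<kappa> * \<epsilon> / (L + 2 * c)" using that(2) unfolding r \<delta> .
        qed
        from log_gap_step[OF theta_pos theta_less gamma_gt r(1) stepsize_pos[OF \<omega>] this]
        have "(if \<omega> \<in> good k then ln \<gamma> else ln \<theta>)
          \<le> ?a (Suc k) - ?a k + (if r \<le> \<Delta> k \<omega> then ln \<gamma> else 0)"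
          by (simp add: next_stepsize[OF \<omega>])
        then show ?thesis using True \<omega> by (auto simp: indicator_def large_step_def split: if_splits)
      qed simp
      have "\<omega> \<in> ?W (Suc k) \<Longrightarrow> \<omega> \<in> ?W k" for k
        unfolding running_def enat_less_T_stop_iff by (blast intro: le_SucI)
      from stopped_telescope[where active = "\<lambda>k. \<omega> \<in> ?W k" and a = ?a, OF this]
      obtain m where "(\<Sum>k<n. if \<omega> \<in> ?W k then ?a (Suc k) - ?a k else 0) = ?a m - ?a 0" by blast
      also have "\<dots> \<le> 0"
        using log_gap_nonpos[OF gamma_gt r(1) stepsize_pos[OF \<omega>], of m] start_large start(2)[OF \<omega>]
        by (simp add: log_gap_def r_def)
      finally have "(\<Sum>k<n. if \<omega> \<in> ?W k then ?a (Suc k) - ?a k else 0) \<le> 0" .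
      moreover have "(\<Sum>k<n. (ln \<gamma> - ln \<theta>) * indicator (?W k \<inter> good k) \<omega> + ln \<theta> * indicator (?W k) \<omega>)
        \<le> (\<Sum>k<n. ln \<gamma> * indicator (?W k \<inter> large_step r k) \<omega>
            + (if \<omega> \<in> ?W k then ?a (Suc k) - ?a k else 0))"
        by (intro sum_mono step)
      ultimately show ?case unfolding sum.distrib[of "\<lambda>k. ln \<gamma> * indicator (?W k \<inter> large_step r k) \<omega>"]
        by linarith
    qed
  qed
  have ev: "?W k \<inter> good k \<in> events" "?W k \<inter> large_step r k \<in> events" for k by measurable
  have int: "integrable P (\<lambda>\<omega>. x * indicat_real A \<omega>)" if "A \<in> events" for x A
    using that by (intro integrable_mult_right integrable_real_indicator) (auto simp: emeasure_eq_measure)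
  have int_step: "integrable P (\<lambda>\<omega>. (ln \<gamma> - ln \<theta>) * indicator (?W k \<inter> good k) \<omega> + ln \<theta> * indicator (?W k) \<omega>)"
    for k by (intro Bochner_Integration.integrable_add int ev running_event)
  have drift: "(p * p0 * ln \<gamma> + (1 - p * p0) * ln \<theta>) * prob (?W k)
    \<le> (ln \<gamma> - ln \<theta>) * prob (?W k \<inter> good k) + ln \<theta> * prob (?W k)" for k
  proof -
    have "(ln \<gamma> - ln \<theta>) * (p * p0 * prob (?W k)) \<le> (ln \<gamma> - ln \<theta>) * prob (?W k \<inter> good k)"
      using prob_good[OF descent] ln by (intro mult_left_mono) auto
    then show ?thesis by (simp add: algebra_simps)
  qed
  have "(p * p0 * ln \<gamma> + (1 - p * p0) * ln \<theta>) * (\<Sum>k<n. prob (?W k))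
    \<le> (\<Sum>k<n. (ln \<gamma> - ln \<theta>) * prob (?W k \<inter> good k) + ln \<theta> * prob (?W k))"
    unfolding sum_distrib_left by (intro sum_mono drift)
  also have "\<dots> = (\<integral>\<omega>. (\<Sum>k<n. (ln \<gamma> - ln \<theta>) * indicator (?W k \<inter> good k) \<omega> + ln \<theta> * indicator (?W k) \<omega>) \<partial>P)"
    by (subst Bochner_Integration.integral_sum[OF int_step])
      (simp add: Bochner_Integration.integral_add[OF int[OF ev(1)] int[OF running_event]] ev)
  also have "\<dots> \<le> (\<integral>\<omega>. (\<Sum>k<n. ln \<gamma> * indicator (?W k \<inter> large_step r k) \<omega>) \<partial>P)"
    by (intro integral_mono_AE pointwise Bochner_Integration.integrable_sum int_step int ev)
  also have "\<dots> = ln \<gamma> * (\<Sum>k<n. prob (?W k \<inter> large_step r k))"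
    using int[OF ev(2)] ev by (subst Bochner_Integration.integral_sum) (auto simp: sum_distrib_left)
  finally show ?thesis unfolding r_def .
qed

text \<open>Each iteration with a large step uses up a fixed amount of the merit function on average.\<close>

lemma sum_large_steps_le:
  assumes r: "0 < r" and \<omega>0: "\<omega>0 \<in> space P"
  shows "(\<Sum>k<n. prob (large_step r k)) \<le> merit f fstar c \<theta> \<gamma> M X \<Delta> S 0 \<omega>0 / (nu_const c \<theta> \<gamma> M * r\<^sup>2)"
proof -
  have "prob (large_step r k) * r\<^sup>2 \<le> (\<integral>\<omega>. (\<Delta> k \<omega>)\<^sup>2 \<partial>P)" for k
  proof -
    have "prob (large_step r k) * r\<^sup>2 = (\<integral>\<omega>. indicator (large_step r k) \<omega> * r\<^sup>2 \<partial>P)"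
      using large_step_event[of r k] by simp
    also have "\<dots> \<le> (\<integral>\<omega>. (\<Delta> k \<omega>)\<^sup>2 \<partial>P)"
    proof (rule integral_mono[OF _ integrable_stepsize_sq])
      show "integrable P (\<lambda>\<omega>. indicator (large_step r k) \<omega> * r\<^sup>2)"
        by (intro integrable_mult_left integrable_real_indicator large_step_event)
          (auto simp: emeasure_eq_measure)
      show "indicator (large_step r k) \<omega> * r\<^sup>2 \<le> (\<Delta> k \<omega>)\<^sup>2" for \<omega>
        using r by (auto simp: indicator_def large_step_def intro: power_mono)
    qed
    finally show ?thesis .
  qed
  then have "(\<Sum>k<n. prob (large_step r k)) * r\<^sup>2 \<le> (\<Sum>k<n. \<integral>\<omega>. (\<Delta> k \<omega>)\<^sup>2 \<partial>P)"
    unfolding sum_distrib_right by (intro sum_mono)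
  then have "nu_const c \<theta> \<gamma> M * ((\<Sum>k<n. prob (large_step r k)) * r\<^sup>2) \<le> merit f fstar c \<theta> \<gamma> M X \<Delta> S 0 \<omega>0"
    using sum_expected_stepsize_sq[OF f_continuous bounded_below error_tail \<omega>0, of n] nu_const_pos
    by (meson less_imp_le mult_left_mono order_trans)
  then show ?thesis
    using nu_const_pos r by (simp add: pos_le_divide_eq mult_ac)
qed

lemma T_stop_measurable: "T_stop gradf X \<epsilon> \<in> measurable P (count_space UNIV)"
proof -
  have "{\<omega> \<in> space P. enat k < T_stop gradf X \<epsilon> \<omega>} \<in> events" for k
    using running_event[of \<epsilon> k] unfolding running_def .
  then have gr: "T_stop gradf X \<epsilon> -` {enat k <..} \<inter> space P \<in> events" for k
    by (simp add: vimage_def Int_def conj_commute)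
  show ?thesis
  proof (rule measurable_count_space_eq2_countable[THEN iffD2, rotated], safe)
    fix t :: enat
    have fin: "T_stop gradf X \<epsilon> -` {enat k} \<inter> space P \<in> events" for k
    proof (cases k)
      case 0
      have "T_stop gradf X \<epsilon> -` {enat 0} \<inter> space P
        = space P - (T_stop gradf X \<epsilon> -` {enat 0 <..} \<inter> space P)" by (auto simp: zero_enat_def[symmetric])
      then show ?thesis using gr 0 by auto
    next
      case (Suc j)
      have "T_stop gradf X \<epsilon> -` {enat k} \<inter> space P
        = (T_stop gradf X \<epsilon> -` {enat j <..} \<inter> space P) - (T_stop gradf X \<epsilon> -` {enat k <..} \<inter> space P)"
      proof -
        have "t = enat k \<longleftrightarrow> enat j < t \<and> \<not> enat k < t" for t
          using Suc by (cases t) auto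
        then show ?thesis by blast
      qed
      then show ?thesis using gr by auto
    qed
    show "T_stop gradf X \<epsilon> -` {t} \<inter> space P \<in> events"
    proof (cases t)
      case infinity
      have "T_stop gradf X \<epsilon> -` {\<infinity>} \<inter> space P
        = space P - (\<Union>k. T_stop gradf X \<epsilon> -` {enat k} \<inter> space P)"
        by auto
      moreover have "(\<Union>k. T_stop gradf X \<epsilon> -` {enat k} \<inter> space P) \<in> events"
        by (rule sets.countable_UN) (use fin in blast)
      ultimately show ?thesis unfolding infinity by (simp only: sets.compl_sets)
    qed (use fin in auto)
  qed auto
qed

text \<open>The expectation of an extended natural number is the sum of its tail probabilities, here the
  probabilities that the search is still running.\<close>

lemma expected_T_stop:
  assumes \<epsilon>: "0 < \<epsilon>" and \<delta>: "\<delta> = 2 * \<kappa> * \<epsilon> / (L + 2 * c)" and start_large: "\<theta> * \<delta> \<le> \<delta>0"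
    and descent: "probabilistic_descent P N M gradf D \<xi> X \<kappa> p \<epsilon>" and \<omega>0: "\<omega>0 \<in> space P"
  defines "B \<equiv> ln \<gamma> / (p * p0 * ln \<gamma> + (1 - p * p0) * ln \<theta>)
              * (merit f fstar c \<theta> \<gamma> M X \<Delta> S 0 \<omega>0 / (nu_const c \<theta> \<gamma> M * \<theta>\<^sup>2 * \<delta>\<^sup>2))"
  shows "AE \<omega> in P. T_stop gradf X \<epsilon> \<omega> < \<infinity>"
    and "integrable P (\<lambda>\<omega>. real (the_enat (T_stop gradf X \<epsilon> \<omega>)))"
    and "(\<integral>\<omega>. real (the_enat (T_stop gradf X \<epsilon> \<omega>)) \<partial>P) \<le> B"
proof -
  let ?T = "T_stop gradf X \<epsilon>"
  have ln: "0 < ln \<gamma>" using gamma_gt by simp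
  have "0 < \<delta>" unfolding \<delta> using \<epsilon> kappa_pos L_pos c_pos by (intro divide_pos_pos) auto
  then have r: "0 < \<theta> * \<delta>" using theta_pos by simp
  have partial: "(\<Sum>k<n. prob (running \<epsilon> k)) \<le> B" for n
  proof -
    have "(p * p0 * ln \<gamma> + (1 - p * p0) * ln \<theta>) * (\<Sum>k<n. prob (running \<epsilon> k))
      \<le> ln \<gamma> * (\<Sum>k<n. prob (running \<epsilon> k \<inter> large_step (\<theta> * \<delta>) k))"
      by (rule sum_running_le_large_steps[OF \<epsilon> \<delta> start_large descent])
    also have "\<dots> \<le> ln \<gamma> * (\<Sum>k<n. prob (large_step (\<theta> * \<delta>) k))"
      using ln by (intro mult_left_mono sum_mono finite_measure_mono) auto
    also have "\<dots> \<le> ln \<gamma> * (merit f fstar c \<theta> \<gamma> M X \<Delta> S 0 \<omega>0 / (nu_const c \<theta> \<gamma> M * (\<theta> * \<delta>)\<^sup>2))"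
      using ln by (intro mult_left_mono sum_large_steps_le r \<omega>0) auto
    also have "nu_const c \<theta> \<gamma> M * (\<theta> * \<delta>)\<^sup>2 = nu_const c \<theta> \<gamma> M * \<theta>\<^sup>2 * \<delta>\<^sup>2"
      by (simp add: power_mult_distrib)
    finally show ?thesis
      unfolding B_def times_divide_eq_left using drift_pos by (simp only: pos_le_divide_eq mult.commute)
  qed
  have B: "0 \<le> B" using partial[of 0] by simp
  have "(\<integral>\<^sup>+\<omega>. ennreal_of_enat (?T \<omega>) \<partial>P) = (\<Sum>k. emeasure P (running \<epsilon> k))"
    unfolding running_def by (rule nn_integral_enat_function[OF T_stop_measurable])
  also have "\<dots> \<le> ennreal B"
  proof (rule suminf_le_const)
    show "(\<Sum>k<n. emeasure P (running \<epsilon> k)) \<le> ennreal B" for n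
      using partial[of n] by (simp add: emeasure_eq_measure ennreal_leI)
  qed simp
  finally have le: "(\<integral>\<^sup>+\<omega>. ennreal_of_enat (?T \<omega>) \<partial>P) \<le> ennreal B" .
  have meas: "(\<lambda>\<omega>. ennreal_of_enat (?T \<omega>)) \<in> borel_measurable P"
    by (rule measurable_compose[OF T_stop_measurable]) simp
  have "AE \<omega> in P. ennreal_of_enat (?T \<omega>) \<noteq> \<infinity>"
    using le by (intro nn_integral_PInf_AE meas) (auto simp: top_unique)
  then show fin: "AE \<omega> in P. ?T \<omega> < \<infinity>"
  proof eventually_elim
    case (elim \<omega>)
    then show ?case by (cases "?T \<omega>") auto
  qed
  have "(\<integral>\<^sup>+\<omega>. ennreal (real (the_enat (?T \<omega>))) \<partial>P) = (\<integral>\<^sup>+\<omega>. ennreal_of_enat (?T \<omega>) \<partial>P)"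
    by (rule nn_integral_cong_AE, use fin in eventually_elim)
      (auto simp: ennreal_of_nat_eq_real_of_nat)
  then have le': "(\<integral>\<^sup>+\<omega>. ennreal (real (the_enat (?T \<omega>))) \<partial>P) \<le> ennreal B" using le by simp
  have "(\<lambda>\<omega>. real (the_enat (?T \<omega>))) \<in> borel_measurable P"
    by (rule measurable_compose[OF T_stop_measurable]) simp
  then show "integrable P (\<lambda>\<omega>. real (the_enat (?T \<omega>)))"
    using le' by (intro integrableI_bounded) (auto simp: less_top[symmetric] top_unique)
  show "(\<integral>\<omega>. real (the_enat (?T \<omega>)) \<partial>P) \<le> B"
    by (rule integral_real_bounded[OF B le'])
qed

end

section \<open>The complexity bound\<close>

theorem theorem4p3:
  fixes P :: "'w measure" and N :: "'z measure"
    and f :: "real ^ 'n \<Rightarrow> real" and gradf :: "real ^ 'n \<Rightarrow> real ^ 'n"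
    and F :: "real ^ 'n \<Rightarrow> 'z \<Rightarrow> real"
    and M :: nat and c \<theta> \<gamma> fstar L \<kappa> p p0 :: real
    and x0 :: "real ^ 'n" and \<delta>0 :: real
    and D X :: "nat \<Rightarrow> 'w \<Rightarrow> real ^ 'n" and \<xi> :: "nat \<Rightarrow> query \<Rightarrow> 'w \<Rightarrow> 'z"
    and \<Delta> :: "nat \<Rightarrow> 'w \<Rightarrow> real" and S :: "nat \<Rightarrow> 'w \<Rightarrow> bool"
  assumes algorithm: "max_M_direct_search P N F M c \<theta> \<gamma> x0 \<delta>0 D \<xi> X \<Delta> S"
    and bounded_below: "\<forall>x. fstar \<le> f x"
    and gradient: "\<forall>x. GDERIV f x :> gradf x"
    and lipschitz: "0 < L" "L-lipschitz_on UNIV gradf"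
    and constants: "0 < \<kappa>" "\<kappa> \<le> 1" "0 < p" "p \<le> 1" "0 \<le> p0" "p0 \<le> 1"
    and error_nonneg: "\<forall>k. AE \<omega> in P.
      cond_pr P (\<F>_half P N M D \<xi> k) (\<lambda>\<omega>'. gain_error F f M D \<xi> X \<Delta> S k \<omega>' \<ge> 0) \<omega> \<ge> p0"
    and error_tail: "\<forall>k. \<forall>b>0. AE \<omega> in P.
      cond_pr P (\<F>_half P N M D \<xi> k) (\<lambda>\<omega>'. gain_error F f M D \<xi> X \<Delta> S k \<omega>' \<ge> b) \<omega>
        \<le> beta_const c \<theta> \<gamma> M * (\<Delta> k \<omega>)\<^sup>2 / b"
    and drift: "p * p0 * ln \<gamma> + (1 - p * p0) * ln \<theta> > 0"
  shows "(\<forall>\<epsilon>>0. \<forall>\<delta>. \<delta> = 2 * \<kappa> * \<epsilon> / (L + 2 * c) \<longrightarrow>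
      probabilistic_descent P N M gradf D \<xi> X \<kappa> p \<epsilon> \<longrightarrow> \<theta> * \<delta> \<le> \<delta>0 \<longrightarrow>
      (AE \<omega> in P. T_stop gradf X \<epsilon> \<omega> < \<infinity>) \<and>
      integrable P (\<lambda>\<omega>. real (the_enat (T_stop gradf X \<epsilon> \<omega>)) - 1) \<and>
      (\<forall>\<omega>0\<in>space P.
         (\<integral>\<omega>. (real (the_enat (T_stop gradf X \<epsilon> \<omega>)) - 1) \<partial>P)
           \<le> ln \<gamma> / (p * p0 * ln \<gamma> + (1 - p * p0) * ln \<theta>)
              * (merit f fstar c \<theta> \<gamma> M X \<Delta> S 0 \<omega>0 / (nu_const c \<theta> \<gamma> M * \<theta>\<^sup>2 * \<delta>\<^sup>2)) \<and>
         ln \<gamma> / (p * p0 * ln \<gamma> + (1 - p * p0) * ln \<theta>)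
              * (merit f fstar c \<theta> \<gamma> M X \<Delta> S 0 \<omega>0 / (nu_const c \<theta> \<gamma> M * \<theta>\<^sup>2 * \<delta>\<^sup>2))
           = ln \<gamma> / (p * p0 * ln \<gamma> + (1 - p * p0) * ln \<theta>)
              * (merit f fstar c \<theta> \<gamma> M X \<Delta> S 0 \<omega>0 * (L + 2 * c)\<^sup>2
                 / (4 * nu_const c \<theta> \<gamma> M * \<theta>\<^sup>2 * \<kappa>\<^sup>2 * \<epsilon>\<^sup>2)))) \<and>
    ((\<forall>\<epsilon>>0. probabilistic_descent P N M gradf D \<xi> X \<kappa> p \<epsilon>) \<longrightarrow>
      (\<forall>\<epsilon>>0. (AE \<omega> in P. T_stop gradf X \<epsilon> \<omega> < \<infinity>) \<and>
             integrable P (\<lambda>\<omega>. real (the_enat (T_stop gradf X \<epsilon> \<omega>)))) \<and>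
      (\<lambda>\<epsilon>. \<integral>\<omega>. real (the_enat (T_stop gradf X \<epsilon> \<omega>)) \<partial>P) \<in> O[at_right 0](\<lambda>\<epsilon>. 1 / \<epsilon>\<^sup>2))"
proof -
  interpret noisy_max_M_search P N F M c \<theta> \<gamma> x0 \<delta>0 D \<xi> X \<Delta> S f gradf fstar L \<kappa> p p0
    by (intro noisy_max_M_search.intro algorithm noisy_max_M_search_axioms.intro)
      (use bounded_below gradient lipschitz constants error_nonneg error_tail drift in auto)
  let ?T = "T_stop gradf X"
  let ?d = "p * p0 * ln \<gamma> + (1 - p * p0) * ln \<theta>"
  let ?\<nu> = "nu_const c \<theta> \<gamma> M" and ?\<Phi> = "merit f fstar c \<theta> \<gamma> M X \<Delta> S 0"
  have other_form: "?\<Phi> \<omega>0 / (?\<nu> * \<theta>\<^sup>2 * (2 * \<kappa> * \<epsilon> / (L + 2 * c))\<^sup>2)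
      = ?\<Phi> \<omega>0 * (L + 2 * c)\<^sup>2 / (4 * ?\<nu> * \<theta>\<^sup>2 * \<kappa>\<^sup>2 * \<epsilon>\<^sup>2)" for \<epsilon> \<omega>0
    by (simp add: power_divide power_mult_distrib mult_ac)
  obtain \<omega>0 where \<omega>0: "\<omega>0 \<in> space P" using not_empty by blast

  have bound: "(AE \<omega> in P. ?T \<epsilon> \<omega> < \<infinity>) \<and>
      integrable P (\<lambda>\<omega>. real (the_enat (?T \<epsilon> \<omega>)) - 1) \<and>
      (\<forall>\<omega>0\<in>space P.
         (\<integral>\<omega>. (real (the_enat (?T \<epsilon> \<omega>)) - 1) \<partial>P) \<le> ln \<gamma> / ?d * (?\<Phi> \<omega>0 / (?\<nu> * \<theta>\<^sup>2 * \<delta>\<^sup>2)) \<and>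
         ln \<gamma> / ?d * (?\<Phi> \<omega>0 / (?\<nu> * \<theta>\<^sup>2 * \<delta>\<^sup>2))
           = ln \<gamma> / ?d * (?\<Phi> \<omega>0 * (L + 2 * c)\<^sup>2 / (4 * ?\<nu> * \<theta>\<^sup>2 * \<kappa>\<^sup>2 * \<epsilon>\<^sup>2)))"
    if \<epsilon>: "0 < \<epsilon>" and \<delta>: "\<delta> = 2 * \<kappa> * \<epsilon> / (L + 2 * c)"
      and descent: "probabilistic_descent P N M gradf D \<xi> X \<kappa> p \<epsilon>" and large: "\<theta> * \<delta> \<le> \<delta>0" for \<epsilon> \<delta>
  proof (intro conjI ballI)
    note E = expected_T_stop[OF \<epsilon> \<delta> large descent]
    show "AE \<omega> in P. ?T \<epsilon> \<omega> < \<infinity>" using E(1)[OF \<omega>0] .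
    show "integrable P (\<lambda>\<omega>. real (the_enat (?T \<epsilon> \<omega>)) - 1)"
      using E(2)[OF \<omega>0] by (intro Bochner_Integration.integrable_diff) auto
    fix \<omega>1 assume \<omega>1: "\<omega>1 \<in> space P"
    have "(\<integral>\<omega>. (real (the_enat (?T \<epsilon> \<omega>)) - 1) \<partial>P) = (\<integral>\<omega>. real (the_enat (?T \<epsilon> \<omega>)) \<partial>P) - 1"
      using E(2)[OF \<omega>0] by (simp add: Bochner_Integration.integral_diff prob_space)
    then show "(\<integral>\<omega>. (real (the_enat (?T \<epsilon> \<omega>)) - 1) \<partial>P) \<le> ln \<gamma> / ?d * (?\<Phi> \<omega>1 / (?\<nu> * \<theta>\<^sup>2 * \<delta>\<^sup>2))"
      using E(3)[OF \<omega>1] by linarith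
    show "ln \<gamma> / ?d * (?\<Phi> \<omega>1 / (?\<nu> * \<theta>\<^sup>2 * \<delta>\<^sup>2))
           = ln \<gamma> / ?d * (?\<Phi> \<omega>1 * (L + 2 * c)\<^sup>2 / (4 * ?\<nu> * \<theta>\<^sup>2 * \<kappa>\<^sup>2 * \<epsilon>\<^sup>2))"
      unfolding \<delta> other_form ..
  qed

  \<comment> \<open>Below this accuracy the initial stepsize is at least \<open>\<theta> * \<delta>\<close>.\<close>
  define \<epsilon>1 where "\<epsilon>1 = \<delta>0 * (L + 2 * c) / (2 * \<kappa> * \<theta>)"
  have pos: "0 < L + 2 * c" "0 < \<kappa>" "0 < \<theta>" "0 < \<delta>0"
    using L_pos c_pos kappa_pos theta_pos parameters(6) by auto
  have \<epsilon>1: "0 < \<epsilon>1" unfolding \<epsilon>1_def using pos by (intro divide_pos_pos mult_pos_pos) auto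
  have large: "\<theta> * (2 * \<kappa> * \<epsilon> / (L + 2 * c)) \<le> \<delta>0" if "\<epsilon> \<le> \<epsilon>1" for \<epsilon>
    using that pos unfolding \<epsilon>1_def by (simp add: pos_le_divide_eq pos_divide_le_eq mult_ac)

  have order: "(\<forall>\<epsilon>>0. (AE \<omega> in P. ?T \<epsilon> \<omega> < \<infinity>) \<and> integrable P (\<lambda>\<omega>. real (the_enat (?T \<epsilon> \<omega>)))) \<and>
      (\<lambda>\<epsilon>. \<integral>\<omega>. real (the_enat (?T \<epsilon> \<omega>)) \<partial>P) \<in> O[at_right 0](\<lambda>\<epsilon>. 1 / \<epsilon>\<^sup>2)"
    if descent: "\<forall>\<epsilon>>0. probabilistic_descent P N M gradf D \<xi> X \<kappa> p \<epsilon>"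
  proof (intro conjI allI impI)
    fix \<epsilon> :: real assume \<epsilon>: "0 < \<epsilon>"
    \<comment> \<open>A coarse accuracy is reached no later than a finer one.\<close>
    define \<epsilon>' where "\<epsilon>' = min \<epsilon> \<epsilon>1"
    have \<epsilon>': "0 < \<epsilon>'" "\<epsilon>' \<le> \<epsilon>1" "\<epsilon>' \<le> \<epsilon>" unfolding \<epsilon>'_def using \<epsilon> \<epsilon>1 by auto
    note E = expected_T_stop[OF \<epsilon>'(1) refl large[OF \<epsilon>'(2)] descent[rule_format, OF \<epsilon>'(1)] \<omega>0]
    have le: "?T \<epsilon> \<omega> \<le> ?T \<epsilon>' \<omega>" for \<omega> by (rule T_stop_antimono[OF \<epsilon>'(3)])
    show "AE \<omega> in P. ?T \<epsilon> \<omega> < \<infinity>"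
      using E(1) by eventually_elim (rule le_less_trans[OF le])
    show "integrable P (\<lambda>\<omega>. real (the_enat (?T \<epsilon> \<omega>)))"
    proof (rule Bochner_Integration.integrable_bound[OF E(2)])
      show "(\<lambda>\<omega>. real (the_enat (?T \<epsilon> \<omega>))) \<in> borel_measurable P"
        by (rule measurable_compose[OF T_stop_measurable]) simp
      show "AE \<omega> in P. norm (real (the_enat (?T \<epsilon> \<omega>))) \<le> norm (real (the_enat (?T \<epsilon>' \<omega>)))"
        using E(1)
      proof eventually_elim
        case (elim \<omega>)
        then show ?case using le[of \<omega>] by (cases "?T \<epsilon> \<omega>"; cases "?T \<epsilon>' \<omega>") auto
      qed
    qed
  next
    define C where "C = ln \<gamma> / ?d * (?\<Phi> \<omega>0 * (L + 2 * c)\<^sup>2 / (4 * ?\<nu> * \<theta>\<^sup>2 * \<kappa>\<^sup>2))"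
    show "(\<lambda>\<epsilon>. \<integral>\<omega>. real (the_enat (?T \<epsilon> \<omega>)) \<partial>P) \<in> O[at_right 0](\<lambda>\<epsilon>. 1 / \<epsilon>\<^sup>2)"
    proof (rule bigoI[where c = C])
      show "\<forall>\<^sub>F \<epsilon> in at_right 0. norm (\<integral>\<omega>. real (the_enat (?T \<epsilon> \<omega>)) \<partial>P) \<le> C * norm (1 / \<epsilon>\<^sup>2)"
        unfolding eventually_at_right_field
      proof (intro exI[of _ \<epsilon>1] conjI allI impI \<epsilon>1)
        fix \<epsilon> :: real assume \<epsilon>: "0 < \<epsilon>" "\<epsilon> < \<epsilon>1"
        have "(\<integral>\<omega>. real (the_enat (?T \<epsilon> \<omega>)) \<partial>P) \<le> C * (1 / \<epsilon>\<^sup>2)"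
          using expected_T_stop(3)[OF \<epsilon>(1) refl large[OF less_imp_le[OF \<epsilon>(2)]] descent[rule_format, OF \<epsilon>(1)] \<omega>0]
          unfolding other_form C_def by (simp add: mult_ac)
        moreover have "0 \<le> (\<integral>\<omega>. real (the_enat (?T \<epsilon> \<omega>)) \<partial>P)"
          by (intro Bochner_Integration.integral_nonneg) simp
        ultimately show "norm (\<integral>\<omega>. real (the_enat (?T \<epsilon> \<omega>)) \<partial>P) \<le> C * norm (1 / \<epsilon>\<^sup>2)"
          by simp
      qed
    qed
  qed
  show ?thesis using bound order by blast
qed

end
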